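(* For every $d \in \mathbb{N}$ (with $d\ge 1$) there is an integer $k=k(d)\ge 3$ such that for all $m,n \in \mathbb{N}$ the following holds: if $(P_0,\mathcal{L}_0)$ is an image, via a projective transformation, of the extended regular $k$-gon (together with its lines), then for every set $P$ of $m$ points from $V_d$ and every set $\mathcal{L}$ of $n$ lines in the plane, the graph $G(P_0,\mathcal{L}_0)$ is not a subgraph of $G(P,\mathcal{L})$. Moreover, for $d=1$ and any integer $k \geq 3$, with $(P_0,\mathcal{L}_0)$ an image of the extended regular $k$-gon (together with its lines) via a projective transformation, the following are equivalent: (i) for all $m,n\in\mathbb{N}$, every set $P$ of $m$ points from $V_1=\mathbb{Q}^2$ and every set $\mathcal{L}$ of $n$ lines in the plane, $G(P_0,\mathcal{L}_0)$ is not a subgraph of $G(P,\mathcal{L})$; (ii) $k \notin \{3,4,6\}$.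
   Context: For a positive integer $d$, $V_d$ is the set of all points of $\mathbb{R}^2$ both of whose coordinates are algebraic numbers of degree at most $d$ over $\mathbb{Q}$; so $V_1=\mathbb{Q}^2$. For a finite set $P$ of points and a finite set $\mathcal{L}$ of lines, the incidence graph $G(P,\mathcal{L})$ is the (oriented) bipartite graph with vertex set $P\cup\mathcal{L}$ in which $(p,L)$, with $p\in P$ and $L\in\mathcal{L}$, is an edge (oriented from $p$ to $L$) if and only if $p\in L$. The same definition is used for points and lines in the real projective plane. "$G(P_0,\mathcal{L}_0)$ is a subgraph of $G(P,\mathcal{L})$" means that there are an injective map $P_0\to P$ and an injective map $\mathcal{L}_0\to\mathcal{L}$ that send incident pairs to incident pairs (the subgraph need not be induced). Extended regular $k$-gon ($k\ge 3$): let $v_1,\dots,v_k$ be the vertices of a regular $k$-gon in $\mathbb{R}^2$, viewed in the real projective plane. The lines $\overline{v_iv_j}$ have exactly $k$ distinct slopes; let $t_1,\dots,t_k$ be the corresponding $k$ points on the line at infinity $L_\infty$, so that every line $\overline{v_iv_j}$ passes through exactly one $t_l$. The extended regular $k$-gon is the set of $2k$ points $v_1,\dots,v_k,t_1,\dots,t_k$; the associated set of $\binom{k}{2}+1$ lines consists of all lines $\overline{v_iv_j}$, $1\le i<j\le k$, together with $L_\infty$. An image $(P_0,\mathcal{L}_0)$ via a projective transformation means the images of these $2k$ points and of these $\binom{k}{2}+1$ lines. *)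

theory Defs
  imports "HOL-Analysis.Analysis" "HOL-Computational_Algebra.Computational_Algebra"
begin

text \<open>
  Degree over the rationals of an algebraic real number, i.e. the degree of its minimal polynomial;
  meaningful only for algebraic arguments, hence the conjunct \<^const>\<open>algebraic\<close> below.
\<close>

definition algebraic_degree :: "real \<Rightarrow> nat" where
  "algebraic_degree x =
     (LEAST n. \<exists>p :: rat poly. p \<noteq> 0 \<and> degree p = n \<and> poly (map_poly of_rat p) x = 0)"

definition V :: "nat \<Rightarrow> (real^2) set" where
  "V d = {x. \<forall>i. algebraic (x $ i) \<and> algebraic_degree (x $ i) \<le> d}"

definition affine_line :: "(real^2) set \<Rightarrow> bool" where
  "affine_line l \<longleftrightarrow> affine l \<and> aff_dim l = 1"


text \<open>
  An incidence graph is kept as its two vertex classes together with the edges, which are oriented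
  from points to lines. The incidence relation is a parameter because it is membership in the affine
  plane but inclusion in the projective plane.
\<close>

definition incidence_graph ::
    "('p \<Rightarrow> 'l \<Rightarrow> bool) \<Rightarrow> 'p set \<Rightarrow> 'l set \<Rightarrow> 'p set \<times> 'l set \<times> ('p \<times> 'l) set" where
  "incidence_graph I P L = (P, L, {(p, l). p \<in> P \<and> l \<in> L \<and> I p l})"

definition is_subgraph ::
    "'p set \<times> 'l set \<times> ('p \<times> 'l) set \<Rightarrow> 'q set \<times> 'm set \<times> ('q \<times> 'm) set \<Rightarrow> bool" where
  "is_subgraph G0 G \<longleftrightarrow>
     (case G0 of (P0, L0, E0) \<Rightarrow> case G of (P, L, E) \<Rightarrow>
        \<exists>f g. inj_on f P0 \<and> f ` P0 \<subseteq> P \<and> inj_on g L0 \<and> g ` L0 \<subseteq> L \<and>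
              (\<forall>(p, l) \<in> E0. (f p, g l) \<in> E))"

abbreviation affine_graph where
  "affine_graph P L \<equiv> incidence_graph (\<lambda>(p :: real^2) l. p \<in> l) P L"


text \<open>
  Points and lines of the real projective plane are the one- and two-dimensional linear subspaces of
  \<^typ>\<open>real^3\<close>, so that a point lies on a line iff it is included in it. The affine plane
  is embedded as the plane of vectors with last coordinate 1.
\<close>

abbreviation projective_graph where
  "projective_graph P L \<equiv> incidence_graph (\<lambda>(p :: (real^3) set) l. p \<subseteq> l) P L"

definition to_projective :: "real^2 \<Rightarrow> (real^3) set" where
  "to_projective x = span {vector [x $ 1, x $ 2, 1]}"

definition line_at_infinity :: "(real^3) set" where
  "line_at_infinity = {x. x $ 3 = 0}"

definition join :: "(real^3) set \<Rightarrow> (real^3) set \<Rightarrow> (real^3) set" where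
  "join p q = span (p \<union> q)"

definition projective_transformation :: "((real^3) set \<Rightarrow> (real^3) set) \<Rightarrow> bool" where
  "projective_transformation T \<longleftrightarrow> (\<exists>f. linear f \<and> bij f \<and> T = (`) f)"


definition regular_polygon :: "nat \<Rightarrow> (nat \<Rightarrow> real^2) \<Rightarrow> bool" where
  "regular_polygon k v \<longleftrightarrow>
     (\<exists>c r \<theta>. r > 0 \<and>
        (\<forall>j<k. v j = c + r *\<^sub>R vector [cos (\<theta> + 2 * pi * j / k), sin (\<theta> + 2 * pi * j / k)]))"

definition secants :: "nat \<Rightarrow> (nat \<Rightarrow> real^2) \<Rightarrow> (real^3) set set" where
  "secants k v = {join (to_projective (v i)) (to_projective (v j)) | i j. i < j \<and> j < k}"

text \<open>
  The points \<open>t\<^sub>l\<close> of the extended polygon are the points at infinity of the secants: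
  parallel secants have the same point at infinity, so there is one for every slope.
\<close>

definition extended_points :: "nat \<Rightarrow> (nat \<Rightarrow> real^2) \<Rightarrow> (real^3) set set" where
  "extended_points k v =
     (\<lambda>i. to_projective (v i)) ` {..<k} \<union> (\<lambda>l. l \<inter> line_at_infinity) ` secants k v"

definition extended_lines :: "nat \<Rightarrow> (nat \<Rightarrow> real^2) \<Rightarrow> (real^3) set set" where
  "extended_lines k v = insert line_at_infinity (secants k v)"

definition image_of_extended_polygon ::
    "nat \<Rightarrow> (real^3) set set \<Rightarrow> (real^3) set set \<Rightarrow> bool" where
  "image_of_extended_polygon k P0 L0 \<longleftrightarrow>
     (\<exists>v T. regular_polygon k v \<and> projective_transformation T \<and>
            P0 = T ` extended_points k v \<and> L0 = T ` extended_lines k v)"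

end

theory Submission
  imports Defs "HOL-Library.Z2"
begin

text \<open>
Suppose that the extended regular \<open>k\<close>-gon, \<open>k \<ge> 5\<close>, is embedded as a subgraph into points and lines
of the affine plane, the vertices going to \<open>w\<^sub>0, \<dots>, w\<^sub>k\<^sub>-\<^sub>1\<close> and the line at infinity going to a line
\<open>l\<close>. The secants \<open>v\<^sub>i v\<^sub>j\<close> and \<open>v\<^sub>a v\<^sub>b\<close> are parallel when \<open>i + j \<equiv> a + b\<close> modulo \<open>k\<close>, so the images of these
secants meet on \<open>l\<close>. Move \<open>l\<close> to infinity by a projective map: the \<open>w\<^sub>i\<close> become points \<open>W\<^sub>i\<close> whose chords
are parallel whenever the chords of the regular polygon are. Comparing three such parallelisms for five
consecutive points gives a constant \<open>\<lambda>\<close> with \<open>W\<^sub>i\<^sub>+\<^sub>3 - W\<^sub>i = \<lambda> (W\<^sub>i\<^sub>+\<^sub>2 - W\<^sub>i\<^sub>+\<^sub>1)\<close>. Hence the edge vectors satisfy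
a two-term linear recurrence with characteristic polynomial \<open>X\<^sup>2 - \<mu> X + 1\<close>, where \<open>\<mu> = \<lambda> - 1\<close>, and since
the polygon closes up after exactly \<open>k\<close> steps, \<open>\<mu> = z + 1/z\<close> for a primitive \<open>k\<close>-th root of unity \<open>z\<close>
(\<open>closed_polygon_parallel_chords\<close>). In other words, the image is a projective image of a regular
polygon or of one of its star-shaped conjugates.

The number \<open>\<mu>\<close> is a rational function of the coordinates of only six points, namely four of the \<open>w\<^sub>i\<close> and two
points of \<open>l\<close>. If their coordinates have degree at most \<open>d\<close>, they lie in an algebra of dimension at most
\<open>d\<^sup>1\<^sup>2\<close> over the rationals, which is closed under division, so \<open>\<mu>\<close> is a root of a nonzero rational
polynomial of degree at most \<open>d\<^sup>1\<^sup>2\<close>, independently of \<open>k\<close> (\<open>embedding_imp_realization\<close>).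

For the first claim let \<open>k\<close> be a power of two. Then \<open>z\<close> has degree \<open>k/2\<close>, because
\<open>X\<^sup>N + 1\<close> is irreducible for \<open>N\<close> a power of two, and thus \<open>\<mu>\<close> has degree at least \<open>k/4\<close>
(\<open>degree_bound_trace_2_power\<close>), which is too large once \<open>k/4 > d\<^sup>1\<^sup>2\<close>. For \<open>d = 1\<close> the number \<open>\<mu>\<close> is rational
and an algebraic integer with \<open>\<bar>\<mu>\<bar> \<le> 2\<close>, hence one of five integers, and \<open>k \<ge> 5\<close> leaves only \<open>k = 6\<close>
(\<open>rational_trace_of_root_of_unity\<close>).

Conversely, for \<open>k\<close> equal to 3, 4 or 6 the constant \<open>\<lambda>\<close> is an integer. In the basis formed by the first three
vertices, in homogeneous coordinates, all vertices and all points at infinity are integral, and a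
change of basis moves all of them into the affine plane (\<open>rational_realization\<close>).
\<close>

section \<open>Polynomials under ring homomorphisms\<close>

lemma map_poly_mult_hom:
  fixes h :: "'a::comm_ring_1 \<Rightarrow> 'b::comm_ring_1"
  assumes add: "\<And>x y. h (x + y) = h x + h y" and mult: "\<And>x y. h (x * y) = h x * h y"
  shows "map_poly h (p * q) = map_poly h p * map_poly h q"
proof (induction p)
  case (pCons a p)
  have h0: "h 0 = 0" using add[of 0 0] by simp
  have "map_poly h (r + s) = map_poly h r + map_poly h s" for r s
    by (intro poly_eqI) (simp add: coeff_map_poly h0 add)
  then show ?case
    by (simp add: pCons map_poly_pCons map_poly_smult h0 mult)
qed simp

lemma poly_map_poly_hom:
  fixes h :: "'a::comm_ring_1 \<Rightarrow> 'b::comm_ring_1"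
  assumes add: "\<And>x y. h (x + y) = h x + h y" and mult: "\<And>x y. h (x * y) = h x * h y"
  shows "poly (map_poly h p) (h x) = h (poly p x)"
proof -
  have h0: "h 0 = 0" using add[of 0 0] by simp
  show ?thesis by (induction p) (simp_all add: h0 map_poly_pCons add mult)
qed

text \<open>
This passes from the rational polynomials that define the degree of a number to integral ones, where Gauss's
lemma and reduction modulo two are available.
\<close>

lemma rat_poly_clear_denominators:
  fixes p :: "rat poly"
  shows "\<exists>(c::int) p'. c \<noteq> 0 \<and> smult (of_int c) p = map_poly of_int p'"
proof (induction p)
  case 0
  show ?case by (intro exI[of _ 1] exI[of _ 0]) simp
next
  case (pCons a p)
  then obtain c p' where c: "c \<noteq> 0" "smult (of_int c) p = map_poly of_int p'" by blast
  obtain u v where q: "quotient_of a = (u, v)" by fastforce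
  have uv: "a = of_int u / of_int v" "v > 0"
    using quotient_of_div[OF q] quotient_of_denom_pos[OF q] by simp_all
  have "smult (of_int (v * c)) (pCons a p) = pCons (of_int (c * u)) (smult (of_int v) (smult (of_int c) p))"
    using uv by simp
  also have "\<dots> = map_poly of_int (pCons (c * u) (smult v p'))"
    unfolding c(2) by (simp add: map_poly_pCons map_poly_smult)
  finally have "smult (of_int (v * c)) (pCons a p) = map_poly of_int (pCons (c * u) (smult v p'))" .
  then show ?case using c(1) uv(2) by (intro exI[of _ "v * c"] exI) auto
qed

lemma poly_map_of_rat_sum:
  "poly (map_poly of_rat p) x = (\<Sum>i\<le>degree p. of_rat (coeff p i) * x ^ i)"
  for x :: "'a::field_char_0"
  by (simp add: poly_altdef degree_map_poly coeff_map_poly)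

section \<open>Primitive roots of unity of two-power order\<close>

lemma frobenius_bit_poly: "(1 + q) ^ (2 ^ n) = 1 + (q :: bit poly) ^ (2 ^ n)"
proof (induction n)
  case (Suc n)
  have two: "(2 :: bit poly) = 0"
    by (metis bit_2_eq_0 of_nat_numeral of_nat_poly pCons_0_0)
  have "(1 + q) ^ (2 ^ Suc n) = (1 + q ^ (2 ^ n)) ^ 2"
    unfolding power_Suc2[of 2 n] power_mult Suc ..
  also have "\<dots> = 1 + (q ^ (2 ^ n)) ^ 2"
    by (simp only: power2_sum two mult_zero_left add_0_right power_one)
  also have "\<dots> = 1 + q ^ (2 ^ Suc n)"
    unfolding power_Suc2[of 2 n] power_mult ..
  finally show ?case .
qed simp

text \<open>
Modulo two, \<open>X\<^sup>N + 1\<close> is \<open>(X + 1)\<^sup>N\<close> for \<open>N\<close> a power of two, so every nonconstant factor has the root 1 modulo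
two. The degree survives the reduction because the leading coefficient divides 1.
\<close>

lemma even_eval_factor_x_pow_2_pow_plus_1:
  fixes f g :: "int poly"
  assumes fg: "f * g = monom 1 (2 ^ n) + 1" and deg: "degree f > 0"
  shows "even (poly f 1)"
proof (rule ccontr)
  assume odd: "\<not> even (poly f 1)"
  define f' where "f' = map_poly (of_int :: int \<Rightarrow> bit) f"
  define g' where "g' = map_poly (of_int :: int \<Rightarrow> bit) g"
  have lc: "lead_coeff f * lead_coeff g = 1"
  proof -
    have "degree (monom (1::int) (2 ^ n) + 1) = 2 ^ n"
      by (subst degree_add_eq_left) (simp_all add: degree_monom_eq)
    then have "lead_coeff (monom (1::int) (2 ^ n) + 1) = 1" by simp
    then show ?thesis by (metis fg lead_coeff_mult)
  qed
  have "f' * g' = map_poly of_int (monom (1::int) (2 ^ n) + 1)"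
    unfolding f'_def g'_def fg[symmetric] by (rule map_poly_mult_hom[symmetric]) simp_all
  also have "\<dots> = 1 + [:0, 1:] ^ (2 ^ n)"
    by (intro poly_eqI) (simp add: coeff_map_poly monom_altdef[of 1, simplified, symmetric] )
  also have "\<dots> = [:1, 1:] ^ (2 ^ n)"
    using frobenius_bit_poly[of "[:0, 1:]" n] by (simp add: one_pCons)
  finally have prod: "f' * g' = [:1, 1:] ^ (2 ^ n)" .
  have "odd (lead_coeff f)" using lc by (metis dvd_mult2 odd_one)
  then have "of_int (lead_coeff f) = (1 :: bit)" by (auto elim!: oddE)
  then have deg': "degree f' > 0"
    unfolding f'_def using deg by (subst map_poly_degree_eq) auto
  have "poly f' 1 = of_int (poly f 1)"
    using poly_map_poly_hom[of "of_int :: int \<Rightarrow> bit" f 1] by (simp add: f'_def)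
  then have "poly f' 1 \<noteq> 0" using odd by (auto elim!: oddE)
  have "is_unit f'" if "f' * h = [:1, 1:] ^ m" for h m
    using that
  proof (induction m arbitrary: h)
    case 0
    then show ?case by (metis dvd_triv_left power_0)
  next
    case (Suc m)
    have "poly (f' * h) 1 = 0" unfolding Suc.prems by simp
    then have "poly h 1 = 0" using \<open>poly f' 1 \<noteq> 0\<close> by simp
    then obtain h' where "h = [:1, 1:] * h'"
      using poly_eq_0_iff_dvd[of h 1] by (auto elim: dvdE)
    with Suc.prems have "[:1, 1:] * (f' * h') = [:1, 1:] * [:1, 1:] ^ m"
      by (simp only: power_Suc ac_simps)
    then have "f' * h' = [:1, 1:] ^ m" by (subst (asm) mult_cancel_left) simp
    then show ?case by (rule Suc.IH)
  qed
  then have "is_unit f'" using prod by blast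
  then show False using deg' by (auto simp: is_unit_poly_iff)
qed

text \<open>
This is Eisenstein's argument for the irreducibility of \<open>X\<^sup>N + 1\<close>, \<open>N\<close> a power of two, after the shift
\<open>X \<mapsto> X + 1\<close>. A primitive integral polynomial \<open>f\<close> of least degree with the root \<open>z\<close> divides \<open>X\<^sup>N + 1\<close> over the
integers. If the cofactor were not constant, both factors would take even values at 1, but the product
takes the value 2 there.
\<close>

lemma degree_rat_poly_root_of_minus_1:
  fixes z :: "'a::field_char_0" and q :: "rat poly"
  assumes z: "z ^ (2 ^ n) = -1" and q: "q \<noteq> 0" "poly (map_poly of_rat q) z = 0"
  shows "degree q \<ge> 2 ^ n"
proof -
  define I where "I = (\<lambda>f::int poly. f \<noteq> 0 \<and> poly (map_poly of_int f) z = 0)"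
  have ev_add: "poly (map_poly of_int (f + g)) z = poly (map_poly of_int f) z + poly (map_poly of_int g) z"
    for f g :: "int poly"
    by (simp add: poly_add[symmetric] del: poly_add)
       (intro arg_cong[of _ _ "\<lambda>p. poly p z"] poly_eqI, simp add: coeff_map_poly)
  have ev_mult: "poly (map_poly of_int (f * g)) z = poly (map_poly of_int f) z * poly (map_poly of_int g) z"
    for f g :: "int poly"
    by (subst map_poly_mult_hom) simp_all
  have ev_smult: "poly (map_poly of_int (smult c f)) z = of_int c * poly (map_poly of_int f) z"
    for c and f :: "int poly"
    by (simp add: map_poly_smult)
  obtain c q' where c: "c \<noteq> 0" "smult (of_int c) q = map_poly of_int q'"
    using rat_poly_clear_denominators by blast
  have degq': "degree q' = degree q"
    using c by (metis degree_map_poly degree_smult_eq of_int_0_eq_iff)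
  have "of_rat (of_int c) * poly (map_poly of_rat q) z = poly (map_poly of_rat (smult (of_int c) q)) z"
    by (simp add: map_poly_smult of_rat_mult)
  also have "\<dots> = poly (map_poly of_int q') z"
    unfolding c(2) by (subst map_poly_map_poly) (simp_all add: o_def)
  finally have Iq': "I q'"
    using q c by (auto simp: I_def)
  define f0 where "f0 = arg_min degree I"
  have f0: "I f0" "\<And>g. I g \<Longrightarrow> degree f0 \<le> degree g"
    unfolding f0_def using arg_min_natI[of I q' degree] arg_min_nat_le[of I _ degree] Iq' by auto
  define f where "f = primitive_part f0"
  have f0_eq: "f0 = smult (content f0) f" by (simp add: f_def)
  have If: "I f"
    using f0(1) ev_smult[of "content f0" f] unfolding I_def
    by (metis f0_eq content_eq_zero_iff mult_eq_0_iff of_int_0_eq_iff smult_0_right)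
  have min: "\<And>g. I g \<Longrightarrow> degree f \<le> degree g" using f0(2) by (simp add: f_def)
  have cf: "content f = 1" unfolding f_def using f0(1) by (simp add: I_def)
  define X where "X = monom (1::int) (2 ^ n) + 1"
  have evX: "poly (map_poly of_int X) z = 0"
    unfolding X_def by (subst ev_add) (simp add: map_poly_monom poly_monom z)
  have degX: "degree X = 2 ^ n" unfolding X_def
    by (subst degree_add_eq_left) (simp_all add: degree_monom_eq)
  have X1: "poly X 1 = 2" by (simp add: X_def poly_monom)
  have contX: "content X = 1"
  proof -
    have "content X dvd coeff X (2 ^ n)" by (rule content_dvd_coeff)
    also have "coeff X (2 ^ n) = 1" by (simp add: X_def)
    finally show ?thesis unfolding is_unit_content_iff .
  qed
  define r where "r = pseudo_mod X f"
  have fnz: "f \<noteq> 0" using If by (simp add: I_def)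
  from pseudo_mod[OF fnz, of X] obtain a g where ag: "a \<noteq> 0" "smult a X = f * g + r"
    and r: "r = 0 \<or> degree r < degree f"
    unfolding r_def by blast
  have "poly (map_poly of_int (smult a X)) z = poly (map_poly of_int (f * g + r)) z"
    by (simp only: ag)
  then have "poly (map_poly of_int r) z = 0"
    using If evX by (simp only: ev_add ev_mult ev_smult I_def) simp
  then have "r = 0" using min[of r] r unfolding I_def by linarith
  then have agX: "smult a X = f * g" using ag by simp
  have gnz: "g \<noteq> 0" using agX ag(1) degX by force
  have cg: "content g = normalize a"
    using arg_cong[OF agX, of content] cf contX by (simp add: content_mult)
  obtain g' where g': "g = smult a g'"
  proof -
    have "g = smult (content g) (primitive_part g)" by simp
    also have "content g = a * unit_factor a"
      unfolding cg by (simp add: abs_sgn)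
    finally show ?thesis using that[of "smult (unit_factor a) (primitive_part g)"] by simp
  qed
  have fg: "f * g' = X"
    using agX ag(1) unfolding g' mult_smult_right by (simp only: smult_cancel)
  have degf: "degree f > 0"
  proof (rule ccontr)
    assume "\<not> degree f > 0"
    then obtain e where "f = [:e:]" by (metis gr0I degree_eq_zeroE)
    then show False using If by (auto simp: I_def map_poly_pCons)
  qed
  have "degree g' = 0"
  proof (rule ccontr)
    assume "degree g' \<noteq> 0"
    then have "even (poly g' 1)"
      using even_eval_factor_x_pow_2_pow_plus_1[of g' f n] fg by (simp add: X_def mult.commute)
    moreover have "even (poly f 1)"
      using even_eval_factor_x_pow_2_pow_plus_1[of f g' n] fg degf by (simp add: X_def)
    ultimately have "4 dvd poly f 1 * poly g' 1" by (auto elim!: evenE)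
    also have "poly f 1 * poly g' 1 = 2" using X1 by (simp flip: fg)
    finally show False by simp
  qed
  then have "degree f = 2 ^ n"
    using fg degX by (metis add.right_neutral degree_mult_eq fnz gnz g' smult_0_right)
  then show ?thesis using min[OF Iq'] degq' by simp
qed

definition primitive_root_of_unity :: "nat \<Rightarrow> complex \<Rightarrow> bool" where
  "primitive_root_of_unity k z \<longleftrightarrow> z ^ k = 1 \<and> (\<forall>m. 0 < m \<and> m < k \<longrightarrow> z ^ m \<noteq> 1)"

text \<open>
Multiplying \<open>p(z + 1/z)\<close> by the power \<open>z\<^sup>D\<close>, where \<open>D\<close> is the degree of \<open>p\<close>, clears the powers of \<open>z\<close> from the
denominators.
\<close>

lemma rat_poly_of_reciprocal_sum:
  fixes p :: "rat poly" and z :: complex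
  assumes p: "p \<noteq> 0" "poly (map_poly of_rat p) \<mu> = 0" and z: "z \<noteq> 0" "of_real \<mu> = z + 1 / z"
  shows "\<exists>q :: rat poly. q \<noteq> 0 \<and> degree q \<le> 2 * degree p \<and> poly (map_poly of_rat q) z = 0"
proof -
  define D where "D = degree p"
  define q where "q = (\<Sum>i\<le>D. smult (coeff p i) ([:1, 0, 1:] ^ i * monom 1 (D - i)))"
  \<comment> \<open>Only the summand for \<open>i = D\<close> has a nonzero constant term.\<close>
  have "poly q 0 = (\<Sum>i\<le>D. if i = D then coeff p i else 0)"
    unfolding q_def poly_sum by (intro sum.cong) (auto simp: poly_monom power_0_left)
  also have "\<dots> = lead_coeff p" by (simp add: D_def)
  finally have "q \<noteq> 0" using p(1) by auto
  moreover have "degree q \<le> 2 * D"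
    unfolding q_def
  proof (rule degree_sum_le)
    fix i assume i: "i \<in> {..D}"
    have "degree (smult (coeff p i) ([:1, 0, 1:] ^ i * monom 1 (D - i)))
        \<le> degree ([:1, 0, 1 :: rat:] ^ i * monom 1 (D - i))" by (rule degree_smult_le)
    also have "\<dots> \<le> degree ([:1, 0, 1 :: rat:] ^ i) + degree (monom (1::rat) (D - i))" by (rule degree_mult_le)
    also have "\<dots> \<le> 2 * i + (D - i)"
      using degree_power_le[of "[:1, 0, 1 :: rat:]" i] degree_monom_le[of "1::rat" "D - i"] by simp
    finally show "degree (smult (coeff p i) ([:1, 0, 1:] ^ i * monom 1 (D - i))) \<le> 2 * D"
      using i by simp
  qed simp
  moreover have "poly (map_poly of_rat q) z = 0"
  proof -
    have hom: "of_rat (x + y) = (of_rat x + of_rat y :: complex)" "of_rat (x * y) = (of_rat x * of_rat y :: complex)" for x y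
      by (simp_all add: of_rat_add of_rat_mult)
    define ev where "ev r = poly (map_poly of_rat r) z" for r
    have ev_mult: "ev (r * s) = ev r * ev s" for r s
      unfolding ev_def by (subst map_poly_mult_hom) (simp_all add: hom)
    have ev_sum: "ev (sum f A) = (\<Sum>i\<in>A. ev (f i))" for f :: "nat \<Rightarrow> rat poly" and A
    proof -
      have "map_poly of_rat (r + s) = (map_poly of_rat r + map_poly of_rat s :: complex poly)" for r s
        by (intro poly_eqI) (simp add: coeff_map_poly hom)
      then have "ev (r + s) = ev r + ev s" for r s by (simp add: ev_def)
      moreover have "ev 0 = 0" by (simp add: ev_def)
      ultimately show ?thesis by (induction A rule: infinite_finite_induct) simp_all
    qed
    have ev_smult: "ev (smult c r) = of_rat c * ev r" for c r
      by (simp add: ev_def map_poly_smult hom)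
    have ev_power: "ev (r ^ i) = ev r ^ i" for r i
      by (induction i) (simp_all add: ev_mult, simp add: ev_def)
    have "ev q = (\<Sum>i\<le>D. of_rat (coeff p i) * ((1 + z * z) ^ i * z ^ (D - i)))"
      unfolding q_def ev_sum ev_smult ev_mult ev_power
      by (simp add: ev_def map_poly_pCons map_poly_monom poly_monom)
    also have "\<dots> = (\<Sum>i\<le>D. z ^ D * (of_rat (coeff p i) * of_real \<mu> ^ i))"
    proof (rule sum.cong[OF refl])
      fix i assume "i \<in> {..D}"
      then have "z ^ D = z ^ i * z ^ (D - i)" by (simp flip: power_add)
      moreover have "1 + z * z = z * of_real \<mu>" unfolding z(2) using z(1) by (simp add: field_simps)
      ultimately show "of_rat (coeff p i) * ((1 + z * z) ^ i * z ^ (D - i)) = z ^ D * (of_rat (coeff p i) * of_real \<mu> ^ i)"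
        by (simp add: power_mult_distrib)
    qed
    also have "\<dots> = z ^ D * of_real (poly (map_poly of_rat p) \<mu>)"
    proof -
      have "of_real (of_rat c :: real) = (of_rat c :: complex)" for c
        by (cases c) (simp add: of_rat_rat)
      then show ?thesis
        unfolding poly_map_of_rat_sum D_def by (simp add: sum_distrib_left of_real_sum)
    qed
    finally show ?thesis using p(2) by (simp add: ev_def)
  qed
  ultimately show ?thesis unfolding D_def by blast
qed

lemma primitive_root_of_unity_power_2:
  assumes "primitive_root_of_unity (2 ^ Suc n) z"
  shows "z ^ (2 ^ n) = -1"
proof -
  have "(z ^ (2 ^ n))\<^sup>2 = 1"
    using assms by (simp add: primitive_root_of_unity_def mult.commute flip: power_mult)
  moreover have "z ^ (2 ^ n) \<noteq> 1" using assms by (simp add: primitive_root_of_unity_def)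
  ultimately show ?thesis by (simp add: power2_eq_1_iff)
qed

text \<open>
The trace \<open>z + 1/z\<close> generates a subfield of index at most two in the field generated by \<open>z\<close>, so it inherits
half of the degree of \<open>z\<close>.
\<close>

lemma degree_bound_trace_2_power:
  fixes p :: "rat poly"
  assumes z: "primitive_root_of_unity (2 ^ Suc n) z" and \<mu>: "of_real \<mu> = z + 1 / z"
    and p: "p \<noteq> 0" "poly (map_poly of_rat p) \<mu> = 0"
  shows "2 ^ n \<le> 2 * degree p"
proof -
  have "z \<noteq> 0" using z by (auto simp: primitive_root_of_unity_def power_0_left)
  from rat_poly_of_reciprocal_sum[OF p this \<mu>] obtain q :: "rat poly"
    where "q \<noteq> 0" "degree q \<le> 2 * degree p" "poly (map_poly of_rat q) z = 0" by blast
  with degree_rat_poly_root_of_minus_1[OF primitive_root_of_unity_power_2[OF z]] show ?thesis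
    using le_trans by blast
qed

section \<open>Roots of unity with rational real part\<close>

text \<open>
These are the monic Chebyshev polynomials, which express \<open>z\<^sup>n + 1/z\<^sup>n\<close> through \<open>z + 1/z\<close>. They witness
that the trace of a root of unity is an algebraic integer.
\<close>

fun dickson :: "nat \<Rightarrow> real poly" where
  "dickson 0 = [:2:]"
| "dickson (Suc 0) = [:0, 1:]"
| "dickson (Suc (Suc n)) = pCons 0 (dickson (Suc n)) - dickson n"

lemma dickson_eval:
  fixes z :: complex
  assumes "z \<noteq> 0" "of_real \<mu> = z + 1 / z"
  shows "of_real (poly (dickson n) \<mu>) = z ^ n + 1 / z ^ n"
proof (induction n rule: induct_nat_012)
  case (ge2 n)
  have "of_real (poly (dickson (Suc (Suc n))) \<mu>)
      = (z + 1 / z) * (z ^ Suc n + 1 / z ^ Suc n) - (z ^ n + 1 / z ^ n)"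
    by (simp add: ge2 assms(2)[symmetric] del: power_Suc)
  also have "\<dots> = z ^ Suc (Suc n) + 1 / z ^ Suc (Suc n)"
    using assms(1) by (simp add: field_simps)
  finally show ?case .
qed (simp_all add: assms)

lemma dickson_monic:
  "degree (dickson (Suc n)) = Suc n \<and> coeff (dickson (Suc n)) (Suc n) = 1"
proof (induction n rule: induct_nat_012)
  case (ge2 n)
  have "degree (pCons 0 (dickson (Suc (Suc n)))) = Suc (Suc (Suc n))"
    using ge2 by (subst degree_pCons_eq) auto
  moreover have "degree (dickson (Suc n)) < Suc (Suc (Suc n))" using ge2 by simp
  ultimately show ?case using ge2
    by (simp only: dickson.simps(3)[of "Suc n"] diff_conv_add_uminus degree_add_eq_left degree_minus)
       (simp add: coeff_eq_0)
qed (simp_all add: numeral_2_eq_2)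

lemma dickson_coeff_Ints: "coeff (dickson n) i \<in> \<int>"
  by (induction n arbitrary: i rule: induct_nat_012)
     (auto simp: coeff_pCons split: nat.splits intro!: Ints_diff)

text \<open>
The trace \<open>\<mu>\<close> is a root of the \<open>k\<close>-th monic Chebyshev polynomial minus 2, so it is an algebraic integer,
and \<open>\<bar>z\<bar> = 1\<close> bounds it by 2. A rational trace is therefore one of \<open>-2, \<dots>, 2\<close>, for which \<open>z\<close> has order 2, 3, 4, 6
and 1, respectively.
\<close>

lemma rational_trace_of_root_of_unity:
  fixes z :: complex
  assumes z: "primitive_root_of_unity k z" and \<mu>: "of_real \<mu> = z + 1 / z" "\<mu> \<in> \<rat>" and k: "k \<ge> 5"
  shows "k = 6"
proof -
  have zk: "z ^ k = 1" and prim: "\<And>m. 0 < m \<Longrightarrow> m < k \<Longrightarrow> z ^ m \<noteq> 1"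
    using z by (auto simp: primitive_root_of_unity_def)
  have z0: "z \<noteq> 0" using zk k by (auto simp: power_0_left)
  obtain n where n: "k = Suc n" using k by (cases k) auto
  have "algebraic_int \<mu>"
  proof (rule algebraic_int.intros)
    let ?p = "dickson k - [:2:]"
    have "degree ?p = degree (dickson k)"
      unfolding diff_conv_add_uminus by (rule degree_add_eq_left) (use dickson_monic[of n] n in simp)
    then show "lead_coeff ?p = 1" using dickson_monic[of n] n by simp
    show "\<forall>i. coeff ?p i \<in> \<int>"
      by (auto simp: dickson_coeff_Ints coeff_pCons split: nat.splits)
    have "of_real (poly (dickson k) \<mu>) = (2 :: complex)" using dickson_eval[OF z0 \<mu>(1), of k] zk by simp
    then show "poly ?p \<mu> = 0" by (simp add: of_real_eq_iff[of _ 2, simplified])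
  qed
  then have "\<mu> \<in> \<int>" using \<mu>(2) by (rule rational_algebraic_int_is_int)
  then obtain m where m: "\<mu> = of_int m" by (auto elim: Ints_cases)
  have "norm z ^ k = 1" using zk by (metis norm_one norm_power)
  then have nz: "norm z = 1" using k power_eq_imp_eq_base[of "norm z" k 1] by simp
  have "\<bar>\<mu>\<bar> = norm (z + 1 / z)" by (metis \<mu>(1) norm_of_real)
  also have "\<dots> \<le> norm z + norm (1 / z)" by (rule norm_triangle_ineq)
  also have "\<dots> = 2" using nz by (simp add: norm_divide)
  finally have "\<bar>m\<bar> \<le> 2" using m by linarith
  then have "m \<in> {-2, -1, 0, 1, 2}" by auto
  have q: "z ^ 2 = of_int m * z - 1"
    using \<mu>(1) z0 unfolding m by (simp add: field_simps power2_eq_square)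
  have q3: "z ^ 3 = of_int m * z ^ 2 - z"
    using arg_cong[OF q, of "\<lambda>x. z * x"] by (simp add: algebra_simps power2_eq_square power3_eq_cube)
  consider "m = -2" | "m = -1" | "m = 0" | "m = 1" | "m = 2"
    using \<open>m \<in> _\<close> by blast
  then show "k = 6"
  proof cases
    case 1
    then have "(z + 1) ^ 2 = 0" using q by (simp add: power2_sum)
    then have "z = -1" by (simp add: add_eq_0_iff2)
    then show ?thesis using prim[of 2] k by simp
  next
    case 2
    then have "z ^ 3 = 1" using q q3 by simp
    then show ?thesis using prim[of 3] k by simp
  next
    case 3
    then have "z ^ 2 = -1" using q by simp
    then have "z ^ 4 = 1" using power_mult[of z 2 2] by simp
    then show ?thesis using prim[of 4] k by simp
  next
    case 4
    then have "z ^ 3 = -1" using q q3 by simp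
    then have z6: "z ^ 6 = 1" using power_mult[of z 3 2] by simp
    then have "\<not> 6 < k" by (metis prim zero_less_numeral)
    moreover have "k \<noteq> 5"
    proof
      assume "k = 5"
      then have "z = 1" using z6 zk by (simp add: eval_nat_numeral)
      then show False using prim[of 1] k by simp
    qed
    ultimately show ?thesis using k by simp
  next
    case 5
    then have "(z - 1) ^ 2 = 0" using q by (simp add: power2_diff)
    then show ?thesis using prim[of 1] k by simp
  qed
qed

section \<open>Finite-dimensional algebras of real numbers over the rationals\<close>

interpretation rat_vs: vector_space "\<lambda>(q::rat) (x::real). of_rat q * x"
  by unfold_locales (simp_all add: algebra_simps of_rat_add of_rat_mult)

text \<open>
The dimension is bounded by means of a spanning set, which need not be independent. Such an algebra is
automatically a field, see \<open>rat_algebra_dim_le_inverse\<close>.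
\<close>

definition rat_algebra_dim_le :: "nat \<Rightarrow> real set \<Rightarrow> bool" where
  "rat_algebra_dim_le n K \<longleftrightarrow>
     (\<exists>B. finite B \<and> card B \<le> n \<and> K = rat_vs.span B) \<and> 1 \<in> K \<and> (\<forall>x\<in>K. \<forall>y\<in>K. x * y \<in> K)"

lemma rat_algebra_dim_le_closed:
  assumes "rat_algebra_dim_le n K"
  shows "1 \<in> K" "0 \<in> K" "x \<in> K \<Longrightarrow> y \<in> K \<Longrightarrow> x + y \<in> K" "x \<in> K \<Longrightarrow> y \<in> K \<Longrightarrow> x - y \<in> K"
    "x \<in> K \<Longrightarrow> y \<in> K \<Longrightarrow> x * y \<in> K" "x \<in> K \<Longrightarrow> x ^ i \<in> K" "x \<in> K \<Longrightarrow> of_rat q * x \<in> K"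
    "(\<And>a. a \<in> A \<Longrightarrow> f a \<in> K) \<Longrightarrow> sum f A \<in> K"
proof -
  obtain B where B: "K = rat_vs.span B" and K: "1 \<in> K" "\<And>x y. x \<in> K \<Longrightarrow> y \<in> K \<Longrightarrow> x * y \<in> K"
    using assms unfolding rat_algebra_dim_le_def by blast
  show "x ^ i \<in> K" if "x \<in> K" using that K by (induction i) auto
  show "of_rat q * x \<in> K" if "x \<in> K" using that unfolding B by (rule rat_vs.span_scale)
  show "1 \<in> K" "0 \<in> K" "x \<in> K \<Longrightarrow> y \<in> K \<Longrightarrow> x + y \<in> K" "x \<in> K \<Longrightarrow> y \<in> K \<Longrightarrow> x - y \<in> K"
    "x \<in> K \<Longrightarrow> y \<in> K \<Longrightarrow> x * y \<in> K" "(\<And>a. a \<in> A \<Longrightarrow> f a \<in> K) \<Longrightarrow> sum f A \<in> K"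
    using K unfolding B
    by (auto intro: rat_vs.span_zero rat_vs.span_add rat_vs.span_diff rat_vs.span_sum)
qed

text \<open>
The \<open>n + 1\<close> powers \<open>x\<^sup>0, \<dots>, x\<^sup>n\<close> cannot be linearly independent in a space of dimension at most \<open>n\<close>. Dependence
is a property of sets, so coinciding powers have to be treated separately.
\<close>

lemma rat_algebra_dim_le_annihilating_poly:
  assumes K: "rat_algebra_dim_le n K" and x: "x \<in> K"
  shows "\<exists>p :: rat poly. p \<noteq> 0 \<and> degree p \<le> n \<and> poly (map_poly of_rat p) x = 0"
proof -
  obtain B where B: "finite B" "card B \<le> n" "K = rat_vs.span B"
    using K unfolding rat_algebra_dim_le_def by blast
  show ?thesis
  proof (cases "inj_on (\<lambda>i. x ^ i) {..n}")
    case False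
    then obtain i j where ij: "i \<le> n" "j \<le> n" "i < j" "x ^ i = x ^ j"
      unfolding inj_on_def by (metis atMost_iff nat_neq_iff)
    define p :: "rat poly" where "p = monom 1 j - monom 1 i"
    have "coeff p j = 1" using ij by (simp add: p_def)
    then have "p \<noteq> 0" by auto
    moreover have "degree p \<le> n"
      using ij unfolding p_def by (intro degree_diff_le) (simp_all add: degree_monom_eq)
    moreover have "map_poly of_rat p = (monom 1 j - monom 1 i :: real poly)"
      by (intro poly_eqI) (simp add: p_def coeff_map_poly of_rat_diff)
    ultimately show ?thesis using ij(4) by (intro exI[of _ p]) (simp add: poly_monom)
  next
    case True
    let ?S = "(\<lambda>i. x ^ i) ` {..n}"
    have "?S \<subseteq> rat_vs.span B"
      using rat_algebra_dim_le_closed(6)[OF K x] B(3) by auto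
    moreover have "card ?S = Suc n" using True by (simp add: card_image)
    ultimately have "rat_vs.dependent ?S"
      using rat_vs.independent_span_bound[OF B(1), of ?S] B(2) by auto
    then obtain u where u: "(\<Sum>v\<in>?S. of_rat (u v) * v) = 0" "\<exists>v\<in>?S. u v \<noteq> 0"
      using rat_vs.dependent_finite[of ?S] by auto
    define p where "p = (\<Sum>i\<le>n. monom (u (x ^ i)) i)"
    have coeff: "coeff p i = (if i \<le> n then u (x ^ i) else 0)" for i
      by (simp add: p_def coeff_sum)
    have "p \<noteq> 0" using u(2) coeff by (metis (no_types, lifting) atMost_iff coeff_0 imageE)
    moreover have dp: "degree p \<le> n" by (rule degree_le) (simp add: coeff)
    moreover have "poly (map_poly of_rat p) x = 0"
    proof -
      have "poly (map_poly of_rat p) x = (\<Sum>i\<le>n. of_rat (coeff p i) * x ^ i)"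
        unfolding poly_map_of_rat_sum using dp
        by (intro sum.mono_neutral_left) (auto intro: coeff_eq_0)
      also have "\<dots> = (\<Sum>v\<in>?S. of_rat (u v) * v)"
        by (simp add: coeff sum.reindex[OF True])
      finally show ?thesis using u(1) by simp
    qed
    ultimately show ?thesis by blast
  qed
qed

text \<open>
An annihilating polynomial of least degree has a nonzero constant term \<open>c\<close>. Solving \<open>c + x q(x) = 0\<close> for the
inverse expresses it as a polynomial in \<open>x\<close>.
\<close>

lemma rat_algebra_dim_le_inverse:
  assumes K: "rat_algebra_dim_le n K" and x: "x \<in> K"
  shows "inverse x \<in> K"
proof (cases "x = 0")
  case True
  then show ?thesis using x by simp
next
  case False
  define A where "A = (\<lambda>p :: rat poly. p \<noteq> 0 \<and> poly (map_poly of_rat p) x = 0)"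
  obtain p0 where "A p0"
    using rat_algebra_dim_le_annihilating_poly[OF K x] unfolding A_def by blast
  define p where "p = arg_min degree A"
  have p: "A p" "\<And>q. A q \<Longrightarrow> degree p \<le> degree q"
    unfolding p_def using arg_min_natI[of A p0 degree] arg_min_nat_le[of A _ degree] \<open>A p0\<close> by auto
  obtain c q where cq: "p = pCons c q" by (rule pCons_cases)
  have ev: "of_rat c + x * poly (map_poly of_rat q) x = 0"
    using p(1) unfolding A_def cq by (simp add: map_poly_pCons)
  have "c \<noteq> 0"
  proof
    assume "c = 0"
    then have "A q" using ev p(1) False unfolding A_def cq by simp
    moreover have "degree q < degree p" using \<open>A q\<close> unfolding cq A_def by simp
    ultimately show False using p(2)[of q] by simp
  qed
  have "x * (of_rat (- inverse c) * poly (map_poly of_rat q) x)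
      = of_rat (- inverse c) * (x * poly (map_poly of_rat q) x)" by simp
  also have "x * poly (map_poly of_rat q) x = of_rat (- c)"
    using ev by (simp add: of_rat_minus add_eq_0_iff)
  also have "of_rat (- inverse c) * of_rat (- c) = (1 :: real)"
    using \<open>c \<noteq> 0\<close> by (simp flip: of_rat_mult)
  finally have "inverse x = of_rat (- inverse c) * poly (map_poly of_rat q) x"
    by (rule inverse_unique)
  also have "\<dots> \<in> K"
    unfolding poly_map_of_rat_sum by (intro rat_algebra_dim_le_closed[OF K] x)
  finally show ?thesis .
qed

text \<open>
The values at \<open>x\<close> of all rational polynomials form the algebra. Division with remainder by an annihilating
polynomial \<open>p\<close> shows that the powers of \<open>x\<close> below the degree of \<open>p\<close> span it.
\<close>

lemma rat_algebra_of_algebraic: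
  assumes x: "algebraic x" and d: "algebraic_degree x \<le> d"
  shows "\<exists>K. rat_algebra_dim_le d K \<and> x \<in> K"
proof -
  from x obtain r where r: "\<And>i. coeff r i \<in> \<rat>" "r \<noteq> 0" "poly r x = 0"
    unfolding algebraic_altdef by blast
  obtain r' where r': "r = map_poly of_rat r'" using ratpolyE[of r] r(1) by auto
  have "\<exists>p :: rat poly. p \<noteq> 0 \<and> degree p = algebraic_degree x \<and> poly (map_poly of_rat p) x = 0"
    unfolding algebraic_degree_def
    by (rule LeastI_ex) (use r r' in \<open>auto intro!: exI[of _ r']\<close>)
  then obtain p :: "rat poly" where p: "p \<noteq> 0" "degree p \<le> d" "poly (map_poly of_rat p) x = 0"
    using d by auto
  define B where "B = (\<lambda>i. x ^ i) ` {..<degree p}"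
  define ev where "ev = (\<lambda>q :: rat poly. poly (map_poly of_rat q) x)"
  have ev_mult: "ev (q * s) = ev q * ev s" for q s
    unfolding ev_def by (subst map_poly_mult_hom) (simp_all add: of_rat_add of_rat_mult)
  have ev_add: "ev (q + s) = ev q + ev s" for q s
  proof -
    have "map_poly of_rat (q + s) = map_poly of_rat q + (map_poly of_rat s :: real poly)"
      by (intro poly_eqI) (simp add: coeff_map_poly of_rat_add)
    then show ?thesis by (simp add: ev_def)
  qed
  have ev_in: "ev q \<in> rat_vs.span B" for q
  proof -
    have "ev q = ev (p * (q div p) + q mod p)" by simp
    also have "\<dots> = ev (q mod p)" using p(3) by (simp only: ev_add ev_mult) (simp add: ev_def)
    also have "\<dots> \<in> rat_vs.span B"
    proof (cases "q mod p = 0")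
      case True
      then show ?thesis by (simp add: ev_def rat_vs.span_zero)
    next
      case False
      then have "degree (q mod p) < degree p" using degree_mod_less[of p q] p(1) by auto
      then show ?thesis
        unfolding ev_def poly_map_of_rat_sum B_def
        by (intro rat_vs.span_sum rat_vs.span_scale rat_vs.span_base) auto
    qed
    finally show ?thesis .
  qed
  have B_sub: "rat_vs.span B = range ev"
  proof
    show "range ev \<subseteq> rat_vs.span B" using ev_in by blast
    have "rat_vs.subspace (range ev)"
    proof (rule rat_vs.subspaceI)
      show "0 \<in> range ev" by (rule range_eqI[of _ _ 0]) (simp add: ev_def)
      show "a + b \<in> range ev" if "a \<in> range ev" "b \<in> range ev" for a b
        using that by (auto simp flip: ev_add)
      show "of_rat c * a \<in> range ev" if a: "a \<in> range ev" for c a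
      proof -
        obtain q where "a = ev q" using a by blast
        then have "of_rat c * a = ev ([:c:] * q)"
          by (simp only: ev_mult) (simp add: ev_def map_poly_pCons)
        then show ?thesis by blast
      qed
    qed
    moreover have "B \<subseteq> range ev"
    proof
      fix b assume "b \<in> B"
      then obtain i where "b = x ^ i" by (auto simp: B_def)
      then have "b = ev (monom 1 i)" by (simp add: ev_def map_poly_monom poly_monom)
      then show "b \<in> range ev" by blast
    qed
    ultimately show "rat_vs.span B \<subseteq> range ev" by (rule rat_vs.span_minimal[rotated])
  qed
  have "rat_algebra_dim_le d (rat_vs.span B)"
    unfolding rat_algebra_dim_le_def
  proof (intro conjI ballI)
    have "finite B" "card B \<le> d"
      using card_image_le[of "{..<degree p}" "\<lambda>i. x ^ i"] p(2) by (auto simp: B_def)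
    then show "\<exists>C. finite C \<and> card C \<le> d \<and> rat_vs.span B = rat_vs.span C" by blast
    show "1 \<in> rat_vs.span B" using ev_in[of 1] by (simp add: ev_def)
    fix a b assume "a \<in> rat_vs.span B" "b \<in> rat_vs.span B"
    then show "a * b \<in> rat_vs.span B" unfolding B_sub by (auto simp flip: ev_mult)
  qed
  moreover have "x \<in> rat_vs.span B"
    using ev_in[of "[:0, 1:]"] by (simp add: ev_def map_poly_pCons)
  ultimately show ?thesis by blast
qed

lemma rat_span_mult:
  assumes x: "x \<in> rat_vs.span X" and y: "y \<in> rat_vs.span Y"
  shows "x * y \<in> rat_vs.span ((\<lambda>(a, b). a * b) ` (X \<times> Y))" (is "_ \<in> rat_vs.span ?XY")
proof -
  have "a * y \<in> rat_vs.span ?XY" if "a \<in> X" for a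
    using y
  proof (induction rule: rat_vs.span_induct_alt)
    case base
    show ?case by (simp add: rat_vs.span_zero)
  next
    case (step c b z)
    have "a * b \<in> ?XY" using step(1) that by auto
    then have "of_rat c * (a * b) + a * z \<in> rat_vs.span ?XY"
      using step(2) by (intro rat_vs.span_add[OF rat_vs.span_scale[OF rat_vs.span_base]])
    then show ?case by (simp add: algebra_simps)
  qed
  note aux = this
  show ?thesis
    using x
  proof (induction rule: rat_vs.span_induct_alt)
    case base
    show ?case by (simp add: rat_vs.span_zero)
  next
    case (step c b z)
    have "of_rat c * (b * y) + z * y \<in> rat_vs.span ?XY"
      using step aux by (intro rat_vs.span_add rat_vs.span_scale)
    then show ?case by (simp add: algebra_simps)
  qed
qed

text \<open>
The products of the elements of two spanning sets span a space that is again closed under multiplication,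
since \<open>(x y) (x' y') = (x x') (y y')\<close>.
\<close>

lemma rat_algebra_compositum:
  assumes K1: "rat_algebra_dim_le m K1" and K2: "rat_algebra_dim_le n K2"
  shows "\<exists>K. rat_algebra_dim_le (m * n) K \<and> K1 \<subseteq> K \<and> K2 \<subseteq> K"
proof -
  obtain X where X: "finite X" "card X \<le> m" "K1 = rat_vs.span X"
    using K1 unfolding rat_algebra_dim_le_def by blast
  obtain Y where Y: "finite Y" "card Y \<le> n" "K2 = rat_vs.span Y"
    using K2 unfolding rat_algebra_dim_le_def by blast
  note c1 = rat_algebra_dim_le_closed[OF K1] and c2 = rat_algebra_dim_le_closed[OF K2]
  define XY where "XY = (\<lambda>(a, b). a * b) ` (X \<times> Y)"
  have prod: "x * y \<in> rat_vs.span XY" if "x \<in> K1" "y \<in> K2" for x y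
    using rat_span_mult that unfolding X(3) Y(3) XY_def by blast
  have sub: "K1 \<subseteq> rat_vs.span XY" "K2 \<subseteq> rat_vs.span XY"
    using prod[of _ 1] prod[of 1] c1(1) c2(1) by auto
  have gen: "a * b \<in> rat_vs.span XY" if "a \<in> XY" "b \<in> XY" for a b
  proof -
    obtain x y x' y' where "a = x * y" "b = x' * y'" "x \<in> X" "x' \<in> X" "y \<in> Y" "y' \<in> Y"
      using \<open>a \<in> XY\<close> \<open>b \<in> XY\<close> unfolding XY_def by auto
    then have "a * b = (x * x') * (y * y')" "x * x' \<in> K1" "y * y' \<in> K2"
      using c1(5) c2(5) rat_vs.span_base unfolding X(3) Y(3) by auto
    then show ?thesis using prod by simp
  qed
  have "rat_algebra_dim_le (m * n) (rat_vs.span XY)"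
    unfolding rat_algebra_dim_le_def
  proof (intro conjI ballI)
    have "card XY \<le> card X * card Y"
      unfolding XY_def using card_image_le[of "X \<times> Y"] X(1) Y(1) by (metis card_cartesian_product finite_cartesian_product)
    also have "\<dots> \<le> m * n" using X(2) Y(2) by (rule mult_le_mono)
    finally show "\<exists>B. finite B \<and> card B \<le> m * n \<and> rat_vs.span XY = rat_vs.span B"
      using X(1) Y(1) by (intro exI[of _ XY]) (auto simp: XY_def)
    show "1 \<in> rat_vs.span XY" using sub(1) c1(1) by blast
    fix a b assume ab: "a \<in> rat_vs.span XY" "b \<in> rat_vs.span XY"
    have "(\<lambda>(a, b). a * b) ` (XY \<times> XY) \<subseteq> rat_vs.span XY" using gen by auto
    then have "rat_vs.span ((\<lambda>(a, b). a * b) ` (XY \<times> XY)) \<subseteq> rat_vs.span XY"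
      by (simp add: rat_vs.span_minimal)
    then show "a * b \<in> rat_vs.span XY" using rat_span_mult[OF ab] by blast
  qed
  then show ?thesis using sub by blast
qed

lemma rat_algebra_of_finite_algebraic:
  assumes "finite S" and "\<And>x. x \<in> S \<Longrightarrow> algebraic x \<and> algebraic_degree x \<le> d"
  shows "\<exists>K. rat_algebra_dim_le (d ^ card S) K \<and> S \<subseteq> K"
  using assms
proof (induction S)
  case empty
  have "1 \<in> rat_vs.span {1}" by (simp add: rat_vs.span_base)
  moreover have "(\<lambda>(a, b). a * b) ` ({1::real} \<times> {1}) = {1}" by auto
  ultimately have "rat_algebra_dim_le 1 (rat_vs.span {1})"
    unfolding rat_algebra_dim_le_def using rat_span_mult[of _ "{1}" _ "{1}"]
    by (auto intro!: exI[of _ "{1}"])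
  then show ?case by auto
next
  case (insert x S)
  then obtain K where K: "rat_algebra_dim_le (d ^ card S) K" "S \<subseteq> K" by auto
  obtain K' where K': "rat_algebra_dim_le d K'" "x \<in> K'"
    using rat_algebra_of_algebraic insert.prems by blast
  show ?case
    using rat_algebra_compositum[OF K'(1) K(1)] K(2) K'(2) insert.hyps by fastforce
qed

section \<open>Closed polygons with the chord directions of a regular polygon\<close>

lemma add_mod_neq:
  fixes i d k :: nat
  assumes "0 < d" "d < k"
  shows "(i + d) mod k \<noteq> i mod k"
proof
  assume "(i + d) mod k = i mod k"
  then have "k dvd (i + d) - i" by (metis le_add1 mod_eq_dvd_iff_nat)
  then show False using assms by (simp add: nat_dvd_not_less)
qed

text \<open>
The sequences for the initial values \<open>1, 0\<close> and \<open>0, 1\<close> are the coefficients of \<open>u\<^sub>0\<close> and \<open>u\<^sub>1\<close> in a vector sequence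
\<open>u\<close> that satisfies the same recurrence.
\<close>

fun recurrence_seq :: "real \<Rightarrow> real \<Rightarrow> real \<Rightarrow> nat \<Rightarrow> real" where
  "recurrence_seq \<mu> a b 0 = a"
| "recurrence_seq \<mu> a b (Suc 0) = b"
| "recurrence_seq \<mu> a b (Suc (Suc n)) = \<mu> * recurrence_seq \<mu> a b (Suc n) - recurrence_seq \<mu> a b n"

lemma ex_reciprocal_sum: "\<exists>z::complex. z \<noteq> 0 \<and> \<mu> = z + 1 / z"
proof -
  define s where "s = csqrt (\<mu>\<^sup>2 - 4)"
  define z where "z = (\<mu> + s) / 2"
  have s2: "s * s = \<mu> * \<mu> - 4"
    using power2_csqrt[of "\<mu>\<^sup>2 - 4"] by (simp add: s_def power2_eq_square)
  have "z * (\<mu> - z) = (\<mu> * \<mu> - s * s) / 4" by (simp add: z_def field_simps)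
  also have "\<dots> = 1" by (simp add: s2)
  finally have "z * (\<mu> - z) = 1" .
  moreover from this have "z \<noteq> 0" by auto
  ultimately have "\<mu> = z + 1 / z" by (simp add: field_simps)
  with \<open>z \<noteq> 0\<close> show ?thesis by blast
qed

text \<open>
Write \<open>u\<^sub>n = \<alpha>\<^sub>n u\<^sub>0 + \<beta>\<^sub>n u\<^sub>1\<close>. If \<open>z\<close> is a root of \<open>X\<^sup>2 - \<mu> X + 1\<close>, then \<open>\<alpha>\<^sub>n + \<beta>\<^sub>n z = z\<^sup>n\<close>, as both sides satisfy the
recurrence and agree for \<open>n \<le> 1\<close>. Periodicity and independence of \<open>u\<^sub>0, u\<^sub>1\<close> give \<open>\<alpha>\<^sub>k = 1\<close>, \<open>\<beta>\<^sub>k = 0\<close>, hence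
\<open>z\<^sup>k = 1\<close>. If already \<open>z\<^sup>m = 1\<close> for some \<open>0 < m < k\<close>, summing the identity over a period of length \<open>m\<close> for both
roots \<open>z\<close> and \<open>1/z\<close> shows that the polygon with edges \<open>u\<^sub>i\<close> closes up after \<open>m\<close> steps.
\<close>

lemma periodic_recurrence_imp_primitive_root:
  fixes u :: "nat \<Rightarrow> 'a::real_vector"
  assumes rec: "\<And>i. u (i + 2) = \<mu> *\<^sub>R u (i + 1) - u i"
    and ind: "\<And>a b. a *\<^sub>R u 0 + b *\<^sub>R u 1 = 0 \<Longrightarrow> a = 0 \<and> b = 0"
    and per: "u k = u 0" and k: "k > 0"
    and part: "\<And>m. 0 < m \<Longrightarrow> m < k \<Longrightarrow> sum u {..<m} \<noteq> 0"
  shows "\<exists>z. primitive_root_of_unity k z \<and> of_real \<mu> = z + 1 / z"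
proof -
  define \<alpha> where "\<alpha> = recurrence_seq \<mu> 1 0"
  define \<beta> where "\<beta> = recurrence_seq \<mu> 0 1"
  have u: "u n = \<alpha> n *\<^sub>R u 0 + \<beta> n *\<^sub>R u 1" for n
  proof (induction n rule: induct_nat_012)
    case (ge2 n)
    have "u (Suc (Suc n)) = \<mu> *\<^sub>R u (Suc n) - u n" using rec[of n] by simp
    also have "\<dots> = \<alpha> (Suc (Suc n)) *\<^sub>R u 0 + \<beta> (Suc (Suc n)) *\<^sub>R u 1"
      unfolding ge2 by (simp add: \<alpha>_def \<beta>_def algebra_simps)
    finally show ?case .
  qed (simp_all add: \<alpha>_def \<beta>_def)
  have pow: "of_real (\<alpha> n) + of_real (\<beta> n) * z = z ^ n"
    if z: "z \<noteq> 0" "of_real \<mu> = z + 1 / z" for z :: complex and n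
  proof (induction n rule: induct_nat_012)
    case (ge2 n)
    have "of_real (\<alpha> (Suc (Suc n))) + of_real (\<beta> (Suc (Suc n))) * z
      = of_real \<mu> * (of_real (\<alpha> (Suc n)) + of_real (\<beta> (Suc n)) * z) - (of_real (\<alpha> n) + of_real (\<beta> n) * z)"
      by (simp add: \<alpha>_def \<beta>_def algebra_simps)
    also have "\<dots> = of_real \<mu> * z ^ Suc n - z ^ n" unfolding ge2 ..
    also have "\<dots> = z ^ Suc (Suc n)" unfolding z(2) using z(1) by (simp add: field_simps)
    finally show ?case .
  qed (simp_all add: \<alpha>_def \<beta>_def)
  obtain z :: complex where z: "z \<noteq> 0" "of_real \<mu> = z + 1 / z"
    using ex_reciprocal_sum by blast
  have "(\<alpha> k - 1) *\<^sub>R u 0 + \<beta> k *\<^sub>R u 1 = u k - u 0"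
    unfolding u[of k] by (simp add: algebra_simps)
  with ind per have ab: "\<alpha> k = 1" "\<beta> k = 0" by fastforce+
  have zk: "z ^ k = 1" using pow[OF z, of k] ab by simp
  \<comment> \<open>At a double root \<open>z = \<plusminus>1\<close> the coefficient \<open>\<beta>\<^sub>n\<close> would grow linearly in \<open>n\<close>.\<close>
  have zz: "z * z \<noteq> 1"
  proof
    assume zz: "z * z = 1"
    then have inv: "1 / z = z" using z(1) by (simp add: field_simps)
    have "of_real (\<beta> n) = of_nat n * z ^ Suc n" for n
    proof (induction n rule: induct_nat_012)
      case 1
      then show ?case using zz by (simp add: \<beta>_def)
    next
      case (ge2 n)
      have "of_real (\<beta> (Suc (Suc n))) = of_real \<mu> * of_real (\<beta> (Suc n)) - of_real (\<beta> n)"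
        by (simp add: \<beta>_def)
      also have "\<dots> = 2 * (of_nat (Suc n)) * (z * z) * z ^ Suc n - of_nat n * z ^ Suc n"
        unfolding ge2 z(2) inv by (simp add: algebra_simps)
      also have "\<dots> = of_nat (Suc (Suc n)) * ((z * z) * z ^ Suc n)"
        unfolding zz by (simp add: algebra_simps)
      finally show ?case by (simp add: mult_ac)
    qed (simp_all add: \<beta>_def)
    from this[of k] show False using ab(2) z(1) k by simp
  qed
  have "z ^ m \<noteq> 1" if m: "0 < m" "m < k" for m
  proof
    assume zm: "z ^ m = 1"
    have z1: "z \<noteq> 1" using zz by auto
    define A where "A = sum \<alpha> {..<m}"
    define B where "B = sum \<beta> {..<m}"
    have "of_real A + of_real B * y = sum (\<lambda>i. y ^ i) {..<m}"
      if "y \<noteq> 0" "of_real \<mu> = y + 1 / y" for y :: complex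
      unfolding pow[OF that, symmetric] A_def B_def by (simp add: sum.distrib sum_distrib_right)
    note S = this
    have S1: "of_real A + of_real B * z = 0"
      using S[OF z] z1 zm by (simp add: geometric_sum)
    have S2: "of_real A + of_real B * (1 / z) = 0"
    proof -
      have "of_real A + of_real B * (1 / z) = (\<Sum>i<m. (1 / z) ^ i)"
        by (rule S) (use z in \<open>simp_all add: add.commute\<close>)
      also have "\<dots> = ((1 / z) ^ m - 1) / (1 / z - 1)"
        by (rule geometric_sum) (use z z1 in simp)
      also have "\<dots> = 0" by (simp add: zm power_one_over)
      finally show ?thesis .
    qed
    have "of_real B * (z * z - 1) = z * ((of_real A + of_real B * z) - (of_real A + of_real B * (1 / z)))"
      using z(1) by (simp add: field_simps)
    then have "B = 0" unfolding S1 S2 using zz by simp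
    then have "A = 0" using S1 by simp
    have "sum u {..<m} = A *\<^sub>R u 0 + B *\<^sub>R u 1"
      unfolding A_def B_def scaleR_left.sum sum.distrib[symmetric] by (rule sum.cong[OF refl u])
    then show False using part[OF m] \<open>A = 0\<close> \<open>B = 0\<close> by simp
  qed
  then show ?thesis using zk z unfolding primitive_root_of_unity_def by blast
qed

text \<open>
The directions \<open>\<tau>\<close> are indexed by the sum of the end points of a chord modulo \<open>k\<close>, as for a regular polygon.
In terms of the edges \<open>u\<^sub>i = W\<^sub>i\<^sub>+\<^sub>1 - W\<^sub>i\<close> the three parallelisms \<open>W\<^sub>i W\<^sub>i\<^sub>+\<^sub>3 \<parallel> W\<^sub>i\<^sub>+\<^sub>1 W\<^sub>i\<^sub>+\<^sub>2\<close>,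
\<open>W\<^sub>i\<^sub>+\<^sub>1 W\<^sub>i\<^sub>+\<^sub>4 \<parallel> W\<^sub>i\<^sub>+\<^sub>2 W\<^sub>i\<^sub>+\<^sub>3\<close> and \<open>W\<^sub>i W\<^sub>i\<^sub>+\<^sub>4 \<parallel> W\<^sub>i\<^sub>+\<^sub>1 W\<^sub>i\<^sub>+\<^sub>3\<close> with factors \<open>\<Lambda>\<^sub>i\<close>, \<open>\<Lambda>\<^sub>i\<^sub>+\<^sub>1\<close> and \<open>c\<close> combine to
\<open>(\<Lambda>\<^sub>i - 1 - c) u\<^sub>i\<^sub>+\<^sub>1 + (\<Lambda>\<^sub>i\<^sub>+\<^sub>1 - 1 - c) u\<^sub>i\<^sub>+\<^sub>2 = 0\<close>, which forces \<open>\<Lambda>\<^sub>i = \<Lambda>\<^sub>i\<^sub>+\<^sub>1\<close>. The third parallelism makes sense only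
for \<open>k \<ge> 5\<close>.
\<close>

lemma closed_polygon_parallel_chords:
  fixes W \<tau> :: "nat \<Rightarrow> 'a::real_vector"
  assumes k: "5 \<le> k" and per: "\<And>i. W (i + k) = W i"
    and par: "\<And>i j. i mod k \<noteq> j mod k \<Longrightarrow> \<exists>c. c \<noteq> 0 \<and> W i - W j = c *\<^sub>R \<tau> ((i + j) mod k)"
    and ind: "\<And>a b x y. a mod k \<noteq> b mod k \<Longrightarrow> x *\<^sub>R \<tau> (a mod k) + y *\<^sub>R \<tau> (b mod k) = 0 \<Longrightarrow> x = 0 \<and> y = 0"
  shows "\<exists>l z. W 3 - W 0 = l *\<^sub>R (W 2 - W 1) \<and> primitive_root_of_unity k z \<and> of_real (l - 1) = z + 1 / z"
proof -
  have par2: "\<exists>c. W a - W b = c *\<^sub>R (W c' - W d)"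
    if ne: "a mod k \<noteq> b mod k" "c' mod k \<noteq> d mod k" and sm: "a + b = c' + d" for a b c' d
  proof -
    obtain x y where "W a - W b = x *\<^sub>R \<tau> ((a + b) mod k)"
      "y \<noteq> 0" "W c' - W d = y *\<^sub>R \<tau> ((a + b) mod k)"
      using par[OF ne(1)] par[OF ne(2)] sm by metis
    then show ?thesis by (intro exI[of _ "x / y"]) simp
  qed
  have "\<exists>l. W (i + 3) - W i = l *\<^sub>R (W (i + 2) - W (i + 1))" for i
    by (rule par2) (use add_mod_neq[of 3 k i] add_mod_neq[of 1 k "i + 1"] k in auto)
  then obtain \<Lambda> where \<Lambda>: "\<And>i. W (i + 3) - W i = \<Lambda> i *\<^sub>R (W (i + 2) - W (i + 1))"
    by metis
  define u where "u i = W (i + 1) - W i" for i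
  have ind_u: "a = 0 \<and> b = 0" if "a *\<^sub>R u i + b *\<^sub>R u (i + 1) = 0" for a b i
  proof -
    obtain x where x: "x \<noteq> 0" "u i = x *\<^sub>R \<tau> ((i + 1 + i) mod k)"
      unfolding u_def using par[of "i + 1" i] add_mod_neq[of 1 k i] k by auto
    obtain y where y: "y \<noteq> 0" "u (i + 1) = y *\<^sub>R \<tau> ((i + 1 + i + 2) mod k)"
      unfolding u_def using par[of "i + 1 + 1" "i + 1"] add_mod_neq[of 1 k "i + 1"] k
      by (auto simp: algebra_simps)
    have "(i + 1 + i) mod k \<noteq> (i + 1 + i + 2) mod k"
      using add_mod_neq[of 2 k "i + 1 + i"] k by auto
    from ind[OF this, of "a * x" "b * y"] that show ?thesis using x y by simp
  qed
  have \<Lambda>_const: "\<Lambda> (i + 1) = \<Lambda> i" for i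
  proof -
    have "\<exists>c. W (i + 4) - W i = c *\<^sub>R (W (i + 3) - W (i + 1))"
      by (rule par2) (use add_mod_neq[of 4 k i] add_mod_neq[of 2 k "i + 1"] k in \<open>auto simp: eval_nat_numeral\<close>)
    then obtain c where c: "W (i + 4) - W i = c *\<^sub>R (W (i + 3) - W (i + 1))" by blast
    have u3: "W (i + 3) = W i + u i + u (i + 1) + u (i + 2)"
      and u4: "W (i + 4) = W i + u i + u (i + 1) + u (i + 2) + u (i + 3)"
      by (simp_all add: u_def eval_nat_numeral)
    have e0: "u i + u (i + 1) + u (i + 2) = \<Lambda> i *\<^sub>R u (i + 1)"
      using \<Lambda>[of i] by (simp add: u_def eval_nat_numeral)
    have e1: "u (i + 1) + u (i + 2) + u (i + 3) = \<Lambda> (i + 1) *\<^sub>R u (i + 2)"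
      using \<Lambda>[of "i + 1"] by (simp add: u_def eval_nat_numeral)
    have e2: "u i + u (i + 1) + u (i + 2) + u (i + 3) = c *\<^sub>R (u (i + 1) + u (i + 2))"
      using c by (simp add: u_def eval_nat_numeral)
    have "(\<Lambda> i - 1 - c) *\<^sub>R u (i + 1) + (\<Lambda> (i + 1) - 1 - c) *\<^sub>R u (i + 1 + 1)
      = (\<Lambda> i *\<^sub>R u (i + 1)) + (\<Lambda> (i + 1) *\<^sub>R u (i + 2)) - u (i + 1) - u (i + 2)
        - c *\<^sub>R (u (i + 1) + u (i + 2))"
      by (simp add: algebra_simps)
    also have "\<dots> = 0"
      unfolding e0[symmetric] e1[symmetric] e2[symmetric] by (simp add: algebra_simps)
    finally show ?thesis using ind_u by fastforce
  qed
  define l where "l = \<Lambda> 0"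
  have l: "\<Lambda> i = l" for i
    by (induction i) (simp_all add: l_def \<Lambda>_const[simplified])
  have "\<exists>z. primitive_root_of_unity k z \<and> of_real (l - 1) = z + 1 / z"
  proof (rule periodic_recurrence_imp_primitive_root[of u])
    show "u (i + 2) = (l - 1) *\<^sub>R u (i + 1) - u i" for i
      using \<Lambda>[of i] unfolding l by (simp add: u_def eval_nat_numeral algebra_simps)
    show "a = 0 \<and> b = 0" if "a *\<^sub>R u 0 + b *\<^sub>R u 1 = 0" for a b
      using ind_u[of a 0 b] that by simp
    show "u k = u 0" using per[of 0] per[of 1] by (simp add: u_def)
    show "k > 0" using k by simp
    show "sum u {..<m} \<noteq> 0" if m: "0 < m" "m < k" for m
    proof -
      have "sum u {..<m} = W m - W 0"
        unfolding u_def using sum_lessThan_telescope[of W m] by simp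
      moreover obtain c where "c \<noteq> 0" "W m - W 0 = c *\<^sub>R \<tau> ((m + 0) mod k)"
        using par[of m 0] m by auto
      moreover have "\<tau> ((m + 0) mod k) \<noteq> 0"
        using ind[of "m + 0" "m + 1" 1 0] add_mod_neq[of 1 k m] k by auto
      ultimately show ?thesis by simp
    qed
  qed
  moreover have "W 3 - W 0 = l *\<^sub>R (W 2 - W 1)"
    using \<Lambda>[of 0] unfolding l by (simp add: numeral_2_eq_2)
  ultimately show ?thesis by blast
qed

section \<open>The extended regular polygon\<close>

definition homogeneous :: "real^2 \<Rightarrow> real^3" where
  "homogeneous x = vector [x $ 1, x $ 2, 1]"

lemma homogeneous_nth [simp]:
  "homogeneous x $ 1 = x $ 1" "homogeneous x $ 2 = x $ 2" "homogeneous x $ 3 = 1"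
  by (simp_all add: homogeneous_def)

lemma homogeneous_inject [simp]: "homogeneous x = homogeneous y \<longleftrightarrow> x = y"
  by (auto simp: vec_eq_iff forall_3 forall_2)

lemma to_projective_eq: "to_projective x = span {homogeneous x}"
  by (simp add: to_projective_def homogeneous_def)

lemma join_span_singletons: "join (span {a}) (span {b}) = span {a, b}"
  unfolding join_def span_eq
proof
  show "span {a} \<union> span {b} \<subseteq> span {a, b}" by (simp add: span_mono)
  show "{a, b} \<subseteq> span (span {a} \<union> span {b})" by (simp add: span_base)
qed

lemma join_to_projective:
  "join (to_projective x) (to_projective y) = span {homogeneous x, homogeneous y}"
  by (simp add: to_projective_eq join_span_singletons)

text \<open>
The chord of a regular polygon through the vertices \<open>i\<close> and \<open>j\<close> is perpendicular to the bisecting angle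
\<open>\<theta> + \<pi> (i + j) / k\<close>, so its direction depends on \<open>m = i + j\<close> only.
\<close>

definition slope_vector :: "nat \<Rightarrow> real \<Rightarrow> nat \<Rightarrow> real^3" where
  "slope_vector k \<theta> m = vector [- sin (\<theta> + pi * m / k), cos (\<theta> + pi * m / k), 0]"

lemma slope_vector_nth [simp]:
  "slope_vector k \<theta> m $ 1 = - sin (\<theta> + pi * m / k)"
  "slope_vector k \<theta> m $ 2 = cos (\<theta> + pi * m / k)"
  "slope_vector k \<theta> m $ 3 = 0"
  by (simp_all add: slope_vector_def)

text \<open>
Raising the index by \<open>k\<close> turns the direction by a straight angle, which does not change the slope.
\<close>

lemma slope_vector_mod:
  assumes k: "k > 0"
  shows "slope_vector k \<theta> m = (- 1) ^ (m div k) *\<^sub>R slope_vector k \<theta> (m mod k)"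
proof -
  have shift: "slope_vector k \<theta> (a + k) = - slope_vector k \<theta> a" for a
  proof -
    have "\<theta> + pi * real (a + k) / k = \<theta> + pi * a / k + pi" using k by (simp add: field_simps)
    then have e: "\<theta> + pi * real (a + k) / k = (\<theta> + pi * a / k) + pi" by simp
    show ?thesis unfolding vec_eq_iff forall_3 vector_uminus_component slope_vector_nth e by simp
  qed
  have "slope_vector k \<theta> (a + n * k) = (- 1) ^ n *\<^sub>R slope_vector k \<theta> a" for a n
  proof (induction n)
    case (Suc n)
    have "slope_vector k \<theta> (a + Suc n * k) = slope_vector k \<theta> (a + n * k + k)"
      by (simp add: algebra_simps)
    then show ?case by (simp only: shift Suc) simp
  qed simp
  from this[of "m mod k" "m div k"] show ?thesis by simp
qed

lemma sin_pi_fraction_nonzero: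
  fixes d :: int
  assumes "\<not> int k dvd d" and k: "k > 0"
  shows "sin (pi * d / k) \<noteq> 0"
proof
  assume "sin (pi * d / k) = 0"
  then obtain i :: int where "pi * d / k = of_int i * pi"
    by (auto simp: sin_zero_iff_int2)
  then have "of_int d = (of_int (i * int k) :: real)" using k by (simp add: field_simps)
  then have "d = i * int k" by linarith
  then show False using assms by simp
qed

lemma slope_vectors_independent:
  assumes ab: "a mod k \<noteq> b mod k" and k: "k > 0"
    and eq: "x *\<^sub>R slope_vector k \<theta> a + y *\<^sub>R slope_vector k \<theta> b = 0"
  shows "x = 0 \<and> y = 0"
proof -
  let ?A = "\<theta> + pi * a / k" and ?B = "\<theta> + pi * b / k"
  have s: "x * sin ?A + y * sin ?B = 0" and c: "x * cos ?A + y * cos ?B = 0"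
    using eq by (auto simp: vec_eq_iff forall_3 algebra_simps)
  have "?A - ?B = pi * (int a - int b) / k"
    by (simp add: diff_divide_distrib right_diff_distrib)
  moreover have "\<not> int k dvd (int a - int b)"
    using ab by (metis mod_eq_dvd_iff of_nat_eq_iff zmod_int)
  ultimately have ne: "sin (?A - ?B) \<noteq> 0" using sin_pi_fraction_nonzero[OF _ k] by metis
  have "x * sin (?A - ?B) = cos ?B * (x * sin ?A + y * sin ?B) - sin ?B * (x * cos ?A + y * cos ?B)"
    by (simp only: sin_diff) (simp add: algebra_simps)
  moreover have "y * sin (?A - ?B) = sin ?A * (x * cos ?A + y * cos ?B) - cos ?A * (x * sin ?A + y * sin ?B)"
    by (simp only: sin_diff) (simp add: algebra_simps)
  ultimately show ?thesis unfolding s c using ne by simp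
qed

lemma regular_polygon_chord:
  assumes v: "\<And>j. j < k \<Longrightarrow>
      v j = c + r *\<^sub>R vector [cos (\<theta> + 2 * pi * real j / real k), sin (\<theta> + 2 * pi * real j / real k)]"
    and ij: "i < k" "j < k"
  shows "homogeneous (v i) - homogeneous (v j) =
    (2 * r * sin (pi * (int i - int j) / k)) *\<^sub>R slope_vector k \<theta> (i + j)"
proof -
  let ?I = "\<theta> + 2 * pi * real i / real k" and ?J = "\<theta> + 2 * pi * real j / real k"
  have h: "(?I + ?J) / 2 = \<theta> + pi * real (i + j) / k" "(?I - ?J) / 2 = pi * (int i - int j) / k"
    "(?J - ?I) / 2 = - (pi * (int i - int j) / k)"
    by (simp_all add: field_simps add_divide_distrib diff_divide_distrib)
  have "cos ?I - cos ?J = - (2 * sin (pi * (int i - int j) / k) * sin (\<theta> + pi * real (i + j) / k))"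
    unfolding cos_diff_cos h by (simp add: algebra_simps)
  moreover have "sin ?I - sin ?J = 2 * sin (pi * (int i - int j) / k) * cos (\<theta> + pi * real (i + j) / k)"
    unfolding sin_diff_sin h ..
  ultimately have "r * cos ?I - r * cos ?J = - (2 * r * sin (pi * (int i - int j) / k) * sin (\<theta> + pi * real (i + j) / k))"
    "r * sin ?I - r * sin ?J = 2 * r * sin (pi * (int i - int j) / k) * cos (\<theta> + pi * real (i + j) / k)"
    by (simp_all only: right_diff_distrib[symmetric] mult_ac mult_minus_right)
  then show ?thesis
    using ij by (simp add: vec_eq_iff forall_3 v)
qed

text \<open>
This is all that the embedding argument uses about a regular polygon: the slopes are indexed by the residues
modulo \<open>k\<close>, the chord through the vertices \<open>i\<close> and \<open>j\<close> having slope \<open>i + j\<close>, and distinct residues give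
distinct slopes.
\<close>

lemma regular_polygon_chord_direction:
  assumes reg: "regular_polygon k v"
  obtains \<tau> :: "nat \<Rightarrow> real^3" where
    "\<And>i j. i < k \<Longrightarrow> j < k \<Longrightarrow> i \<noteq> j \<Longrightarrow>
      \<exists>c. c \<noteq> 0 \<and> homogeneous (v i) - homogeneous (v j) = c *\<^sub>R \<tau> ((i + j) mod k)"
    "\<And>m. \<tau> m $ 3 = 0"
    "\<And>a b x y. a < k \<Longrightarrow> b < k \<Longrightarrow> a \<noteq> b \<Longrightarrow> x *\<^sub>R \<tau> a + y *\<^sub>R \<tau> b = 0 \<Longrightarrow> x = 0 \<and> y = 0"
proof -
  obtain c r \<theta> where r: "r > 0" and v: "\<And>j. j < k \<Longrightarrow>
      v j = c + r *\<^sub>R vector [cos (\<theta> + 2 * pi * real j / real k), sin (\<theta> + 2 * pi * real j / real k)]"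
    using reg unfolding regular_polygon_def by blast
  show thesis
  proof (rule that[of "slope_vector k \<theta>"])
    fix i j assume ij: "i < k" "j < k" "i \<noteq> j"
    have "\<not> int k dvd (int i - int j)"
      using ij by (metis mod_eq_dvd_iff mod_less of_nat_eq_iff zmod_int)
    then have "sin (pi * (int i - int j) / k) \<noteq> 0"
      using ij by (intro sin_pi_fraction_nonzero) auto
    then show "\<exists>c. c \<noteq> 0 \<and> homogeneous (v i) - homogeneous (v j) = c *\<^sub>R slope_vector k \<theta> ((i + j) mod k)"
      using r ij
      by (intro exI[of _ "2 * r * sin (pi * (int i - int j) / k) * (- 1) ^ ((i + j) div k)"] conjI)
        (simp, simp only: regular_polygon_chord[OF v ij(1,2)] slope_vector_mod[of k \<theta> "i + j"] scaleR_scaleR)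
  next
    show "x = 0 \<and> y = 0" if "a < k" "b < k" "a \<noteq> b"
      "x *\<^sub>R slope_vector k \<theta> a + y *\<^sub>R slope_vector k \<theta> b = 0" for a b x y
      using slope_vectors_independent[of a k b x \<theta> y] that by simp
  qed simp
qed

lemma secant_inter_line_at_infinity:
  fixes t :: "real^3"
  assumes c: "c \<noteq> 0" "homogeneous x - homogeneous y = c *\<^sub>R t" and t: "t $ 3 = 0"
  shows "join (to_projective x) (to_projective y) \<inter> line_at_infinity = span {t}"
  unfolding join_to_projective
proof
  show "span {homogeneous x, homogeneous y} \<inter> line_at_infinity \<subseteq> span {t}"
  proof
    fix p assume p: "p \<in> span {homogeneous x, homogeneous y} \<inter> line_at_infinity"
    then obtain a b where ab: "p = a *\<^sub>R homogeneous x + b *\<^sub>R homogeneous y"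
      by (auto simp: span_insert span_singleton algebra_simps)
    have "p $ 3 = a + b" unfolding ab by simp
    then have "b = - a" using p by (simp add: line_at_infinity_def)
    then have "p = a *\<^sub>R (c *\<^sub>R t)" unfolding ab c(2)[symmetric] by (simp add: algebra_simps)
    then show "p \<in> span {t}" unfolding span_singleton by (metis rangeI scaleR_scaleR)
  qed
  have "t = (1 / c) *\<^sub>R (homogeneous x - homogeneous y)" using c by simp
  also have "\<dots> \<in> span {homogeneous x, homogeneous y}"
    by (intro span_scale span_diff span_base) auto
  finally have "span {t} \<subseteq> span {homogeneous x, homogeneous y}"
    by (simp add: span_minimal)
  moreover have "span {t} \<subseteq> line_at_infinity"
    using t by (auto simp: span_singleton line_at_infinity_def)
  ultimately show "span {t} \<subseteq> span {homogeneous x, homogeneous y} \<inter> line_at_infinity" by blast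
qed

text \<open>
Every residue \<open>m\<close> is the sum of two distinct residues, \<open>0 + m\<close> or \<open>1 + (k - 1)\<close>, so each of the \<open>k\<close> slopes
occurs among the points at infinity.
\<close>

lemma extended_polygon_incidences:
  assumes reg: "regular_polygon k v" and k: "k \<ge> 3"
  obtains slope where
    "\<And>m. m < k \<Longrightarrow> slope m \<in> extended_points k v"
    "inj_on slope {..<k}" "inj_on (\<lambda>i. to_projective (v i)) {..<k}"
    "\<And>i m. m < k \<Longrightarrow> to_projective (v i) \<noteq> slope m"
    "\<And>m. m < k \<Longrightarrow> slope m \<subseteq> line_at_infinity"
    "\<And>i j. i < k \<Longrightarrow> j < k \<Longrightarrow> i \<noteq> j \<Longrightarrow>
      join (to_projective (v i)) (to_projective (v j)) \<in> extended_lines k v \<and>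
      slope ((i + j) mod k) \<subseteq> join (to_projective (v i)) (to_projective (v j)) \<and>
      to_projective (v i) \<subseteq> join (to_projective (v i)) (to_projective (v j)) \<and>
      to_projective (v j) \<subseteq> join (to_projective (v i)) (to_projective (v j)) \<and>
      join (to_projective (v i)) (to_projective (v j)) \<noteq> line_at_infinity"
proof -
  obtain \<tau> :: "nat \<Rightarrow> real^3" where chord: "\<And>i j. i < k \<Longrightarrow> j < k \<Longrightarrow> i \<noteq> j \<Longrightarrow>
      \<exists>c. c \<noteq> 0 \<and> homogeneous (v i) - homogeneous (v j) = c *\<^sub>R \<tau> ((i + j) mod k)"
    and \<tau>3: "\<And>m. \<tau> m $ 3 = 0"
    and ind: "\<And>a b x y. a < k \<Longrightarrow> b < k \<Longrightarrow> a \<noteq> b \<Longrightarrow> x *\<^sub>R \<tau> a + y *\<^sub>R \<tau> b = 0 \<Longrightarrow> x = 0 \<and> y = 0"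
    using regular_polygon_chord_direction[OF reg] by blast
  let ?p = "\<lambda>i. to_projective (v i)"
  have \<tau>_nz: "\<tau> m \<noteq> 0" if "m < k" for m
  proof -
    obtain m' where "m' < k" "m \<noteq> m'"
    proof (cases "m = 0")
      case True
      show thesis by (rule that[of 1]) (use k True in simp_all)
    next
      case False
      show thesis by (rule that[of 0]) (use k False in simp_all)
    qed
    then show ?thesis using ind[of m m' 1 0] that by auto
  qed
  have sec: "join (?p i) (?p j) \<inter> line_at_infinity = span {\<tau> ((i + j) mod k)}"
    if "i < k" "j < k" "i \<noteq> j" for i j
    using secant_inter_line_at_infinity chord[OF that] \<tau>3 by blast
  have sub: "?p i \<subseteq> join (?p i) (?p j)" "?p j \<subseteq> join (?p i) (?p j)" for i j
    by (auto simp: join_def span_base)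
  have join_commute: "join p q = join q p" for p q by (simp add: join_def Un_commute)
  have secant: "join (?p i) (?p j) \<in> secants k v" if "i < k" "j < k" "i \<noteq> j" for i j
  proof (cases "i < j")
    case True
    then show ?thesis using that unfolding secants_def by blast
  next
    case False
    then have "j < i" using that by simp
    then show ?thesis using that unfolding secants_def join_commute[of "?p i" "?p j"] by blast
  qed
  have pt_not_inf: "\<not> ?p i \<subseteq> line_at_infinity" for i
  proof
    assume "?p i \<subseteq> line_at_infinity"
    then have "homogeneous (v i) \<in> line_at_infinity"
      unfolding to_projective_eq by (meson in_mono insertI1 span_base)
    then show False by (simp add: line_at_infinity_def)
  qed
  show thesis
  proof (rule that[of "\<lambda>m. span {\<tau> m}"])
    show "span {\<tau> m} \<in> extended_points k v" if m: "m < k" for m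
    proof -
      obtain i j where ij: "i < k" "j < k" "i \<noteq> j" "(i + j) mod k = m"
      proof (cases "m = 0")
        case True
        then show thesis using that[of 1 "k - 1"] k by auto
      next
        case False
        then show thesis using that[of 0 m] m by auto
      qed
      then have "span {\<tau> m} = join (?p i) (?p j) \<inter> line_at_infinity" using sec by simp
      then show ?thesis using secant[of i j] ij unfolding extended_points_def by auto
    qed
    show "inj_on (\<lambda>m. span {\<tau> m}) {..<k}"
    proof (rule inj_onI, rule ccontr)
      fix a b assume ab: "a \<in> {..<k}" "b \<in> {..<k}" "span {\<tau> a} = span {\<tau> b}" "a \<noteq> b"
      have "\<tau> a \<in> span {\<tau> b}" using ab(3) span_base[of "\<tau> a" "{\<tau> a}"] by simp
      then obtain x where "\<tau> a = x *\<^sub>R \<tau> b" by (auto simp: span_singleton)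
      then have "1 *\<^sub>R \<tau> a + (- x) *\<^sub>R \<tau> b = 0" by simp
      then show False using ind[of a b 1 "- x"] ab by simp
    qed
    show "inj_on ?p {..<k}"
    proof (rule inj_onI, rule ccontr)
      fix i j assume ij: "i \<in> {..<k}" "j \<in> {..<k}" "?p i = ?p j" "i \<noteq> j"
      have "homogeneous (v i) \<in> span {homogeneous (v j)}"
        using ij(3) span_base[of "homogeneous (v i)" "{homogeneous (v i)}"] by (simp add: to_projective_eq)
      then obtain x where x: "homogeneous (v i) = x *\<^sub>R homogeneous (v j)" by (auto simp: span_singleton)
      have "x = 1" using arg_cong[OF x, of "\<lambda>p :: real^3. p $ 3"] by simp
      moreover obtain c where "c \<noteq> 0" "homogeneous (v i) - homogeneous (v j) = c *\<^sub>R \<tau> ((i + j) mod k)"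
        using chord[of i j] ij by auto
      ultimately show False using x \<tau>_nz[of "(i + j) mod k"] k by simp
    qed
    show inf: "span {\<tau> m} \<subseteq> line_at_infinity" for m
      using \<tau>3 by (auto simp: span_singleton line_at_infinity_def)
    show "?p i \<noteq> span {\<tau> m}" for i m
    proof
      assume e: "?p i = span {\<tau> m}"
      show False using pt_not_inf[of i] inf[of m] unfolding e by contradiction
    qed
    fix i j assume ij: "i < k" "j < k" "i \<noteq> j"
    show "join (?p i) (?p j) \<in> extended_lines k v \<and>
      span {\<tau> ((i + j) mod k)} \<subseteq> join (?p i) (?p j) \<and> ?p i \<subseteq> join (?p i) (?p j) \<and>
      ?p j \<subseteq> join (?p i) (?p j) \<and> join (?p i) (?p j) \<noteq> line_at_infinity"
    proof (intro conjI sub)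
      show "join (?p i) (?p j) \<in> extended_lines k v"
        using secant[OF ij] by (simp add: extended_lines_def)
      show "span {\<tau> ((i + j) mod k)} \<subseteq> join (?p i) (?p j)"
        unfolding sec[OF ij, symmetric] by (rule Int_lower1)
      show "join (?p i) (?p j) \<noteq> line_at_infinity"
      proof
        assume e: "join (?p i) (?p j) = line_at_infinity"
        show False using sub(1)[of i j] pt_not_inf[of i] unfolding e by contradiction
      qed
    qed
  qed
qed

section \<open>Realizations of the extended regular polygon in the affine plane\<close>

lemma affine_line_eq_affine_hull:
  assumes "affine_line l" "p \<in> l" "q \<in> l" "p \<noteq> q"
  shows "l = affine hull {p, q}"
proof -
  have "affine hull {p, q} = l"
  proof (rule affine_dim_equal)
    show "affine hull {p, q} \<subseteq> l" using assms by (simp add: affine_line_def hull_minimal)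
    show "aff_dim (affine hull {p, q}) = aff_dim l" using assms by (simp add: affine_line_def)
  qed (use assms in \<open>simp_all add: affine_line_def\<close>)
  then show ?thesis ..
qed

text \<open>
This is the determinant of the vectors from \<open>a\<close> to \<open>b\<close> and from \<open>a\<close> to \<open>x\<close> up to sign. Unlike an arbitrary
equation of the line through \<open>a\<close> and \<open>b\<close>, its coefficients are polynomials in the coordinates of these two points.
\<close>

definition line_form :: "real^2 \<Rightarrow> real^2 \<Rightarrow> real^2 \<Rightarrow> real" where
  "line_form a b x = (x $ 1 - a $ 1) * (b $ 2 - a $ 2) - (x $ 2 - a $ 2) * (b $ 1 - a $ 1)"

lemma mem_affine_line_iff_line_form:
  assumes l: "affine_line l" "a \<in> l" "b \<in> l" "a \<noteq> b"
  shows "x \<in> l \<longleftrightarrow> line_form a b x = 0"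
proof
  assume "x \<in> l"
  then obtain u v where "u + v = 1" "x = u *\<^sub>R a + v *\<^sub>R b"
    using affine_line_eq_affine_hull[OF l] by (auto simp: affine_hull_2)
  moreover from this have "u = 1 - v" by simp
  ultimately have x: "x = (1 - v) *\<^sub>R a + v *\<^sub>R b" by simp
  show "line_form a b x = 0" unfolding x by (simp add: line_form_def algebra_simps)
next
  assume z: "line_form a b x = 0"
  then have z: "(x $ 1 - a $ 1) * (b $ 2 - a $ 2) = (x $ 2 - a $ 2) * (b $ 1 - a $ 1)"
    by (simp add: line_form_def)
  obtain s where s: "s * (b $ 1 - a $ 1) = x $ 1 - a $ 1" "s * (b $ 2 - a $ 2) = x $ 2 - a $ 2"
  proof (cases "b $ 1 = a $ 1")
    case True
    then have n: "b $ 2 \<noteq> a $ 2" using l(4) by (auto simp: vec_eq_iff forall_2)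
    show thesis
      by (rule that[of "(x $ 2 - a $ 2) / (b $ 2 - a $ 2)"]) (use z True n in simp_all)
  next
    case n: False
    show thesis
      by (rule that[of "(x $ 1 - a $ 1) / (b $ 1 - a $ 1)"]) (use z n in simp_all)
  qed
  then have "x = (1 - s) *\<^sub>R a + s *\<^sub>R b"
    by (simp add: vec_eq_iff forall_2 algebra_simps)
  then show "x \<in> l"
    unfolding affine_line_eq_affine_hull[OF l] affine_hull_2 mem_Collect_eq
    by (intro exI[of _ "1 - s"] exI[of _ s]) simp
qed

text \<open>
Dividing the homogeneous coordinates of a point by the linear form of a line moves this line to infinity.
The difference of two points normalized in this way lies in the direction of the intersection of their
connecting line with the line at infinity, which is \<open>t\<close>.
\<close>

lemma parallel_in_projective_chart:
  assumes ij: "line_form a b x \<noteq> 0" "line_form a b y \<noteq> 0" "line_form a b t = 0" "x \<noteq> y"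
    and t: "t \<in> affine hull {x, y}"
  shows "\<exists>c. c \<noteq> 0 \<and> (1 / line_form a b x) *\<^sub>R homogeneous x - (1 / line_form a b y) *\<^sub>R homogeneous y
     = c *\<^sub>R homogeneous t"
proof -
  let ?\<phi> = "line_form a b"
  obtain u s where us: "u + s = 1" "t = u *\<^sub>R x + s *\<^sub>R y" using t by (auto simp: affine_hull_2)
  have u: "u = 1 - s" using us by simp
  have "?\<phi> t = u * ?\<phi> x + s * ?\<phi> y" unfolding us(2) u by (simp add: line_form_def algebra_simps)
  then have e: "s * ?\<phi> y = - (u * ?\<phi> x)" using ij(3) by simp
  have "homogeneous t = u *\<^sub>R homogeneous x + s *\<^sub>R homogeneous y"
    unfolding us(2) vec_eq_iff forall_3 using us(1) by simp
  also have "\<dots> = (u * ?\<phi> x) *\<^sub>R ((1 / ?\<phi> x) *\<^sub>R homogeneous x) + (s * ?\<phi> y) *\<^sub>R ((1 / ?\<phi> y) *\<^sub>R homogeneous y)"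
    using ij by simp
  also have "\<dots> = (u * ?\<phi> x) *\<^sub>R ((1 / ?\<phi> x) *\<^sub>R homogeneous x - (1 / ?\<phi> y) *\<^sub>R homogeneous y)"
    unfolding e by (simp add: algebra_simps)
  finally have h: "homogeneous t = (u * ?\<phi> x) *\<^sub>R ((1 / ?\<phi> x) *\<^sub>R homogeneous x - (1 / ?\<phi> y) *\<^sub>R homogeneous y)" .
  have "u * ?\<phi> x \<noteq> 0"
  proof
    assume "u * ?\<phi> x = 0"
    then have "homogeneous t $ 3 = 0" using h by simp
    then show False by simp
  qed
  then show ?thesis using h by (intro exI[of _ "1 / (u * ?\<phi> x)"]) simp
qed

text \<open>
A point \<open>w\<^sub>i\<close> cannot lie on \<open>l\<close>, since otherwise the line through \<open>w\<^sub>i\<close> and \<open>w\<^sub>j\<close>, which also meets \<open>l\<close> in another point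
\<open>t\<^sub>m\<close>, would coincide with \<open>l\<close>. Hence the chart in which \<open>l\<close> is at infinity is defined at all \<open>w\<^sub>i\<close>. The factor
\<open>\<lambda>\<close> is a quotient of coordinate differences of \<open>W\<^sub>0, \<dots>, W\<^sub>3\<close>, and these involve the coordinates of
\<open>w\<^sub>0, \<dots>, w\<^sub>3, t\<^sub>1, t\<^sub>2\<close> only. This explains the exponent 12.
\<close>

lemma polygon_realization_trace:
  fixes w t :: "nat \<Rightarrow> real^2"
  assumes k: "k \<ge> 5"
    and lines: "\<And>i j. i < k \<Longrightarrow> j < k \<Longrightarrow> i \<noteq> j \<Longrightarrow>
      affine_line (G i j) \<and> w i \<in> G i j \<and> w j \<in> G i j \<and> t ((i + j) mod k) \<in> G i j \<and> G i j \<noteq> l"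
    and l: "affine_line l" "\<And>m. m < k \<Longrightarrow> t m \<in> l"
    and w: "inj_on w {..<k}" and t: "inj_on t {..<k}" and wt: "\<And>i m. i < k \<Longrightarrow> m < k \<Longrightarrow> w i \<noteq> t m"
    and V: "\<And>i. i < k \<Longrightarrow> w i \<in> V d" "\<And>m. m < k \<Longrightarrow> t m \<in> V d" and d: "d \<ge> 1"
  shows "\<exists>\<mu> z p. primitive_root_of_unity k z \<and> of_real \<mu> = z + 1 / z \<and>
    (p :: rat poly) \<noteq> 0 \<and> degree p \<le> d ^ 12 \<and> poly (map_poly of_rat p) \<mu> = 0"
proof -
  let ?\<phi> = "line_form (t 1) (t 2)"
  define W where "W i = (1 / ?\<phi> (w (i mod k))) *\<^sub>R homogeneous (w (i mod k))" for i
  have t12: "t 1 \<noteq> t 2" using t k by (auto dest: inj_onD)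
  have mem_l: "x \<in> l \<longleftrightarrow> ?\<phi> x = 0" for x
    using mem_affine_line_iff_line_form[OF l(1) _ _ t12] l(2) k by simp
  have w_not_l: "?\<phi> (w i) \<noteq> 0" if i: "i < k" for i
  proof
    assume "?\<phi> (w i) = 0"
    then have wl: "w i \<in> l" using mem_l by simp
    obtain j where j: "j < k" "i \<noteq> j"
    proof (cases "i = 0")
      case True
      show thesis by (rule that[of 1]) (use k True in simp_all)
    next
      case False
      show thesis by (rule that[of 0]) (use k False in simp_all)
    qed
    let ?m = "(i + j) mod k"
    have m: "?m < k" using k by simp
    have "G i j = affine hull {w i, t ?m}"
      using lines[OF i j] wt[OF i m] by (intro affine_line_eq_affine_hull) auto
    also have "\<dots> = l"
      using l(2)[OF m] wl wt[OF i m] l(1) by (intro affine_line_eq_affine_hull[symmetric]) auto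
    finally show False using lines[OF i j] by simp
  qed
  have "\<exists>l z. W 3 - W 0 = l *\<^sub>R (W 2 - W 1) \<and> primitive_root_of_unity k z \<and> of_real (l - 1) = z + 1 / z"
  proof (rule closed_polygon_parallel_chords[OF k, where \<tau> = "\<lambda>m. homogeneous (t m)"])
    show "W (i + k) = W i" for i by (simp add: W_def)
    show "\<exists>c. c \<noteq> 0 \<and> W i - W j = c *\<^sub>R homogeneous (t ((i + j) mod k))" if ij: "i mod k \<noteq> j mod k" for i j
    proof -
      have lt: "i mod k < k" "j mod k < k" "(i + j) mod k < k" using k by simp_all
      note L = lines[OF lt(1,2) ij]
      have ww: "w (i mod k) \<noteq> w (j mod k)" using w ij lt by (auto dest: inj_onD)
      then have "G (i mod k) (j mod k) = affine hull {w (i mod k), w (j mod k)}"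
        using L by (intro affine_line_eq_affine_hull) auto
      then have "t ((i + j) mod k) \<in> affine hull {w (i mod k), w (j mod k)}"
        using L by (simp add: mod_add_eq)
      then show ?thesis unfolding W_def
        using w_not_l lt ww l(2) mem_l by (intro parallel_in_projective_chart) auto
    qed
    show "x = 0 \<and> y = 0" if "a mod k \<noteq> b mod k"
      "x *\<^sub>R homogeneous (t (a mod k)) + y *\<^sub>R homogeneous (t (b mod k)) = 0" for a b x y
    proof -
      let ?a = "t (a mod k)" and ?b = "t (b mod k)"
      have "?a \<noteq> ?b" using t that(1) k by (auto dest: inj_onD)
      then obtain i where i: "?a $ i \<noteq> ?b $ i" by (auto simp: vec_eq_iff)
      have e: "x * ?a $ 1 + y * ?b $ 1 = 0" "x * ?a $ 2 + y * ?b $ 2 = 0" "x + y = 0"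
        using that(2) by (auto simp: vec_eq_iff forall_3)
      have y: "y = - x" using e(3) by simp
      have "x * (?a $ i - ?b $ i) = 0"
        using e(1,2) exhaust_2[of i] unfolding y by (auto simp: algebra_simps)
      then show ?thesis using i y by simp
    qed
  qed
  then obtain lam z where lam: "W 3 - W 0 = lam *\<^sub>R (W 2 - W 1)"
    and z: "primitive_root_of_unity k z" "of_real (lam - 1) = z + 1 / z" by blast
  define Q where "Q = {w 0, w 1, w 2, w 3, t 1, t 2}"
  define S where "S = (\<lambda>(x, i). x $ i) ` (Q \<times> (UNIV :: 2 set))"
  have QV: "Q \<subseteq> V d" using V k unfolding Q_def by auto
  have finQ: "finite Q" by (simp add: Q_def)
  have "card Q \<le> 6"
    unfolding Q_def using card_length[of "[w 0, w 1, w 2, w 3, t 1, t 2]"] by simp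
  moreover have "card S \<le> card (Q \<times> (UNIV :: 2 set))" unfolding S_def using finQ by (intro card_image_le) simp
  ultimately have cardS: "card S \<le> 12" by (simp add: card_cartesian_product)
  have "\<exists>K. rat_algebra_dim_le (d ^ card S) K \<and> S \<subseteq> K"
    by (rule rat_algebra_of_finite_algebraic) (use QV finQ in \<open>auto simp: S_def V_def\<close>)
  then obtain K where K: "rat_algebra_dim_le (d ^ card S) K" and SK: "S \<subseteq> K" by blast
  note closed = rat_algebra_dim_le_closed[OF K]
  have QK: "x $ i \<in> K" if "x \<in> Q" for x :: "real^2" and i using that SK unfolding S_def by auto
  have \<phi>K: "?\<phi> x \<in> K" if "x \<in> Q" for x
    unfolding line_form_def by (intro closed(4,5) QK that) (simp_all add: Q_def)
  have hK: "homogeneous x $ i \<in> K" if "x \<in> Q" for x :: "real^2" and i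
    using exhaust_3[of i] QK[OF that] closed(1) by auto
  have WK: "W i $ j \<in> K" if "i < 4" for i j
  proof -
    have "i \<in> {0, 1, 2, 3}" using that by auto
    then have "w (i mod k) \<in> Q" using k unfolding Q_def by auto
    then have "inverse (?\<phi> (w (i mod k))) * homogeneous (w (i mod k)) $ j \<in> K"
      by (intro closed(5) rat_algebra_dim_le_inverse[OF K] hK \<phi>K)
    then show ?thesis by (simp add: W_def divide_inverse)
  qed
  have "W 2 \<noteq> W 1"
  proof
    assume e: "W 2 = W 1"
    have "w 1 = w 2"
    proof -
      have "W 1 $ 3 = 1 / ?\<phi> (w 1)" "W 2 $ 3 = 1 / ?\<phi> (w 2)" using k by (simp_all add: W_def)
      then have "?\<phi> (w 1) = ?\<phi> (w 2)" using e by simp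
      moreover have "homogeneous (w i) = ?\<phi> (w i) *\<^sub>R W i" if "i < k" for i
        using that w_not_l[OF that] by (simp add: W_def)
      ultimately have "homogeneous (w 1) = homogeneous (w 2)" using e k by simp
      then show ?thesis by simp
    qed
    then show False using w k by (auto dest: inj_onD)
  qed
  then obtain j where j: "W 2 $ j - W 1 $ j \<noteq> 0" by (auto simp: vec_eq_iff)
  have "lam = (W 3 $ j - W 0 $ j) * inverse (W 2 $ j - W 1 $ j)"
    using arg_cong[OF lam, of "\<lambda>x :: real^3. x $ j"] j by (simp add: field_simps)
  also have "\<dots> \<in> K"
    by (intro closed(5) closed(4) rat_algebra_dim_le_inverse[OF K] WK) simp_all
  finally have "lam - 1 \<in> K" using closed(1) by (rule closed(4))
  then obtain p :: "rat poly" where p: "p \<noteq> 0" "degree p \<le> d ^ card S"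
    "poly (map_poly of_rat p) (lam - 1) = 0"
    using rat_algebra_dim_le_annihilating_poly[OF K] by blast
  have "d ^ card S \<le> d ^ 12" using d cardS by (intro power_increasing)
  then show ?thesis using p z by (intro exI[of _ "lam - 1"] exI[of _ z] exI[of _ p]) auto
qed

text \<open>
A subgraph embedding is injective on the points and on the lines, so distinct points at infinity keep distinct
images and no secant is identified with the line at infinity.
\<close>

lemma embedding_imp_realization:
  assumes img: "image_of_extended_polygon k P0 L0" and k: "k \<ge> 5"
    and sub: "is_subgraph (projective_graph P0 L0) (affine_graph P L)"
    and P: "P \<subseteq> V d" and L: "\<forall>l\<in>L. affine_line l" and d: "d \<ge> 1"
  shows "\<exists>\<mu> z p. primitive_root_of_unity k z \<and> of_real \<mu> = z + 1 / z \<and>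
    (p :: rat poly) \<noteq> 0 \<and> degree p \<le> d ^ 12 \<and> poly (map_poly of_rat p) \<mu> = 0"
proof -
  obtain v T where reg: "regular_polygon k v" and T: "projective_transformation T"
    and P0: "P0 = T ` extended_points k v" and L0: "L0 = T ` extended_lines k v"
    using img unfolding image_of_extended_polygon_def by blast
  obtain h where h: "bij h" "T = (`) h" using T unfolding projective_transformation_def by blast
  have injT: "T x = T y \<longleftrightarrow> x = y" for x y using h by (simp add: inj_image_eq_iff bij_is_inj)
  have monoT: "x \<subseteq> y \<Longrightarrow> T x \<subseteq> T y" for x y using h by auto
  obtain f g where fg: "inj_on f P0" "f ` P0 \<subseteq> P" "inj_on g L0" "g ` L0 \<subseteq> L"
    and inc: "\<And>p l. p \<in> P0 \<Longrightarrow> l \<in> L0 \<Longrightarrow> p \<subseteq> l \<Longrightarrow> f p \<in> g l"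
    using sub unfolding is_subgraph_def incidence_graph_def by auto
  have k3: "k \<ge> 3" using k by simp
  obtain slope where sl: "\<And>m. m < k \<Longrightarrow> slope m \<in> extended_points k v"
    "inj_on slope {..<k}" "inj_on (\<lambda>i. to_projective (v i)) {..<k}"
    "\<And>i m. m < k \<Longrightarrow> to_projective (v i) \<noteq> slope m"
    "\<And>m. m < k \<Longrightarrow> slope m \<subseteq> line_at_infinity"
    "\<And>i j. i < k \<Longrightarrow> j < k \<Longrightarrow> i \<noteq> j \<Longrightarrow>
      join (to_projective (v i)) (to_projective (v j)) \<in> extended_lines k v \<and>
      slope ((i + j) mod k) \<subseteq> join (to_projective (v i)) (to_projective (v j)) \<and>
      to_projective (v i) \<subseteq> join (to_projective (v i)) (to_projective (v j)) \<and>
      to_projective (v j) \<subseteq> join (to_projective (v i)) (to_projective (v j)) \<and>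
      join (to_projective (v i)) (to_projective (v j)) \<noteq> line_at_infinity"
    by (rule extended_polygon_incidences[OF reg k3], rule that)
  have pt: "to_projective (v i) \<in> extended_points k v" if "i < k" for i
    using that by (simp add: extended_points_def)
  have linf: "line_at_infinity \<in> extended_lines k v" by (simp add: extended_lines_def)
  define F where "F p = f (T p)" for p
  define H where "H l = g (T l)" for l
  have F_inj: "F p = F q \<longleftrightarrow> p = q" if "p \<in> extended_points k v" "q \<in> extended_points k v" for p q
    using that fg(1) injT unfolding P0 F_def by (auto dest: inj_onD)
  have H_inj: "H p = H q \<longleftrightarrow> p = q" if "p \<in> extended_lines k v" "q \<in> extended_lines k v" for p q
    using that fg(3) injT unfolding L0 H_def by (auto dest: inj_onD)
  have F_inc: "F p \<in> H l" if "p \<in> extended_points k v" "l \<in> extended_lines k v" "p \<subseteq> l" for p l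
    unfolding F_def H_def by (rule inc) (use that monoT in \<open>auto simp: P0 L0\<close>)
  have FV: "F p \<in> V d" if "p \<in> extended_points k v" for p
    using that fg(2) P unfolding P0 F_def by auto
  have H_line: "affine_line (H l)" if "l \<in> extended_lines k v" for l
    using that fg(4) L unfolding L0 H_def by auto
  show ?thesis
  proof (rule polygon_realization_trace[where w = "\<lambda>i. F (to_projective (v i))" and t = "\<lambda>m. F (slope m)"
        and G = "\<lambda>i j. H (join (to_projective (v i)) (to_projective (v j)))" and l = "H line_at_infinity"])
    fix i j assume ij: "i < k" "j < k" "i \<noteq> j"
    have "(i + j) mod k < k" using ij by simp
    then show "affine_line (H (join (to_projective (v i)) (to_projective (v j)))) \<and>
      F (to_projective (v i)) \<in> H (join (to_projective (v i)) (to_projective (v j))) \<and>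
      F (to_projective (v j)) \<in> H (join (to_projective (v i)) (to_projective (v j))) \<and>
      F (slope ((i + j) mod k)) \<in> H (join (to_projective (v i)) (to_projective (v j))) \<and>
      H (join (to_projective (v i)) (to_projective (v j))) \<noteq> H line_at_infinity"
      using sl(6)[OF ij] ij by (auto simp: H_inj linf pt sl(1) intro!: H_line F_inc)
  next
    show "inj_on (\<lambda>i. F (to_projective (v i))) {..<k}"
      using sl(3) pt by (auto simp: inj_on_def F_inj)
    show "inj_on (\<lambda>m. F (slope m)) {..<k}"
      using sl(1,2) by (auto simp: inj_on_def F_inj)
    show "F (slope m) \<in> H line_at_infinity" if "m < k" for m
      by (intro F_inc sl linf that)
  qed (use k d in \<open>auto simp: F_inj pt sl intro!: H_line F_inc linf FV\<close>)
qed

section \<open>Rational realizations for the triangle, the square and the hexagon\<close>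

text \<open>
The ratio of the two parallel chords is \<open>sin (3\<pi>/k) / sin (\<pi>/k)\<close>, which is the integer \<open>l\<close> in these three cases.
\<close>

lemma regular_polygon_closing_relation:
  assumes reg: "regular_polygon k v" and kl: "(k, l :: int) \<in> {(3, 0), (4, 1), (6, 2)}" and i: "i + 3 < k"
  shows "homogeneous (v (i + 3)) - homogeneous (v i) =
    of_int l *\<^sub>R (homogeneous (v (i + 2)) - homogeneous (v (i + 1)))"
proof -
  obtain c r \<theta> where r: "r > 0" and v: "\<And>j. j < k \<Longrightarrow>
      v j = c + r *\<^sub>R vector [cos (\<theta> + 2 * pi * real j / real k), sin (\<theta> + 2 * pi * real j / real k)]"
    using reg unfolding regular_polygon_def by blast
  have s: "sin (pi * 3 / k) = l * sin (pi * 1 / k)"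
  proof -
    consider "k = 3 \<and> l = 0" | "k = 4 \<and> l = 1" | "k = 6 \<and> l = 2" using kl by blast
    then show ?thesis
    proof cases
      case 2
      have "pi * 3 / 4 = pi - pi / 4" by simp
      then have "sin (pi * 3 / 4) = sin (pi / 4)" by (simp only: sin_pi_minus)
      then show ?thesis using 2 by (simp add: sin_45)
    next
      case 3
      have "pi * 3 / 6 = pi / 2" by simp
      then show ?thesis using 3 by (simp add: sin_30)
    qed simp
  qed
  have e: "i + 3 + i = 2 * i + 3" "i + 2 + (i + 1) = 2 * i + 3"
    "int (i + 3) - int i = 3" "int (i + 2) - int (i + 1) = 1" by simp_all
  have chord3: "homogeneous (v (i + 3)) - homogeneous (v i) =
      (2 * r * sin (pi * real_of_int (int (i + 3) - int i) / k)) *\<^sub>R slope_vector k \<theta> (i + 3 + i)"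
    by (rule regular_polygon_chord) (use v i in auto)
  have chord1: "homogeneous (v (i + 2)) - homogeneous (v (i + 1)) =
      (2 * r * sin (pi * real_of_int (int (i + 2) - int (i + 1)) / k)) *\<^sub>R slope_vector k \<theta> (i + 2 + (i + 1))"
    by (rule regular_polygon_chord) (use v i in auto)
  show ?thesis unfolding chord3 chord1 e of_int_1 of_int_numeral s by simp
qed

lemma span_singleton_scaleR:
  fixes a :: "'a::real_vector"
  assumes "c \<noteq> 0"
  shows "span {c *\<^sub>R a} = span {a}"
  unfolding span_eq
proof
  show "{c *\<^sub>R a} \<subseteq> span {a}" by (simp add: span_scale span_base)
  have "a = (1 / c) *\<^sub>R (c *\<^sub>R a)" using assms by simp
  also have "\<dots> \<in> span {c *\<^sub>R a}" by (intro span_scale span_base) simp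
  finally show "{a} \<subseteq> span {c *\<^sub>R a}" by simp
qed

lemma rational_point_in_V_1:
  fixes x :: "real^2"
  assumes "\<And>i. x $ i \<in> \<rat>"
  shows "x \<in> V 1"
proof -
  have "algebraic_degree y \<le> 1" if "y \<in> \<rat>" for y
  proof -
    obtain q where q: "y = of_rat q" using \<open>y \<in> \<rat>\<close> by (auto elim: Rats_cases)
    have "poly (map_poly of_rat [:- q, 1:]) y = 0"
      by (simp add: map_poly_pCons q of_rat_minus)
    then have "\<exists>p :: rat poly. p \<noteq> 0 \<and> degree p = 1 \<and> poly (map_poly of_rat p) y = 0"
      by (intro exI[of _ "[:- q, 1:]"]) simp
    then show ?thesis unfolding algebraic_degree_def by (rule Least_le)
  qed
  then show ?thesis using assms by (auto simp: V_def rat_imp_algebraic)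
qed

text \<open>
The map \<open>E\<close> identifies the affine plane with a chart of the projective plane that contains all points of
\<open>P0\<close>. A line of \<open>L0\<close> contains two of these points, so its trace in the chart is an affine line
that determines it.
\<close>

lemma projective_configuration_in_affine_chart:
  assumes E: "linear E" "inj E"
    and P0: "finite P0" "\<And>p. p \<in> P0 \<Longrightarrow> \<exists>x\<in>A. p = span {E (homogeneous x)}"
    and L0: "finite L0" "\<And>l. l \<in> L0 \<Longrightarrow> \<exists>p\<in>P0. \<exists>q\<in>P0. p \<noteq> q \<and> l = join p q"
  shows "\<exists>P L. P \<subseteq> A \<and> finite P \<and> (\<forall>l\<in>L. affine_line l) \<and> finite L \<and>
    is_subgraph (projective_graph P0 L0) (affine_graph P L)"
proof -
  obtain f where f: "\<And>p. p \<in> P0 \<Longrightarrow> f p \<in> A" "\<And>p. p \<in> P0 \<Longrightarrow> p = span {E (homogeneous (f p))}"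
    using P0(2) by metis
  define g where "g (l :: (real^3) set) = {x. E (homogeneous x) \<in> l}" for l
  have inc: "f p \<in> g l" if "p \<in> P0" "p \<subseteq> l" for p and l
    using that(2) f(2)[OF that(1)] span_base[of "E (homogeneous (f p))" "{E (homogeneous (f p))}"]
    unfolding g_def by auto
  have contains: "p \<subseteq> l" if p: "p \<in> P0" and l: "subspace l" "f p \<in> g l" for p l
    using span_minimal[of "{E (homogeneous (f p))}" l] l f(2)[OF p] by (simp add: g_def)
  have sub_join: "p \<subseteq> join p q" "q \<subseteq> join p q" "subspace (join p q)" for p q
    by (auto simp: join_def span_base)
  have g_line: "affine_line (g l)" if l: "l \<in> L0" for l
  proof -
    obtain p q where pq: "p \<in> P0" "q \<in> P0" "p \<noteq> q" "l = join p q" using L0(2)[OF l] by blast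
    define x where "x = f p"
    define y where "y = f q"
    have p: "p = span {E (homogeneous x)}" and q: "q = span {E (homogeneous y)}"
      using f(2) pq by (simp_all add: x_def y_def)
    have "x \<noteq> y" using p q pq(3) by auto
    have "g l = affine hull {x, y}"
    proof
      have "x \<in> g l" "y \<in> g l" using inc pq sub_join by (auto simp: x_def y_def)
      then have mem: "E (homogeneous x) \<in> l" "E (homogeneous y) \<in> l" by (simp_all add: g_def)
      show "affine hull {x, y} \<subseteq> g l"
      proof
        fix z assume "z \<in> affine hull {x, y}"
        then obtain u v where uv: "u + v = 1" "z = u *\<^sub>R x + v *\<^sub>R y" by (auto simp: affine_hull_2)
        then have "homogeneous z = u *\<^sub>R homogeneous x + v *\<^sub>R homogeneous y"
          by (simp add: vec_eq_iff forall_3)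
        then have "E (homogeneous z) = u *\<^sub>R E (homogeneous x) + v *\<^sub>R E (homogeneous y)"
          using E(1) by (simp add: linear_add linear_scale)
        also have "\<dots> \<in> l" using mem sub_join(3)[of p q] unfolding pq(4)
          by (intro subspace_add subspace_scale)
        finally show "z \<in> g l" by (simp add: g_def)
      qed
      show "g l \<subseteq> affine hull {x, y}"
      proof
        fix z assume "z \<in> g l"
        then have "E (homogeneous z) \<in> span {E (homogeneous x), E (homogeneous y)}"
          by (simp add: g_def pq(4) p q join_span_singletons)
        then obtain a b where "E (homogeneous z) = a *\<^sub>R E (homogeneous x) + b *\<^sub>R E (homogeneous y)"
          by (auto simp: span_insert span_singleton algebra_simps)
        also have "\<dots> = E (a *\<^sub>R homogeneous x + b *\<^sub>R homogeneous y)"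
          using E(1) by (simp add: linear_add linear_scale)
        finally have e: "homogeneous z = a *\<^sub>R homogeneous x + b *\<^sub>R homogeneous y"
          using E(2) by (auto dest: injD)
        then have "a + b = 1" "z = a *\<^sub>R x + b *\<^sub>R y"
          by (auto simp: vec_eq_iff forall_3 forall_2)
        then show "z \<in> affine hull {x, y}" by (auto simp: affine_hull_2)
      qed
    qed
    then show ?thesis using \<open>x \<noteq> y\<close> by (simp add: affine_line_def)
  qed
  have g_mono: "l \<subseteq> l'" if l: "l \<in> L0" "l' \<in> L0" and e: "g l = g l'" for l l'
  proof -
    obtain p q where pq: "p \<in> P0" "q \<in> P0" "p \<noteq> q" "l = join p q" using L0(2)[OF l(1)] by blast
    have sl: "subspace l'" using L0(2)[OF l(2)] sub_join(3) by blast
    have "f p \<in> g l'" "f q \<in> g l'" using inc pq sub_join e by auto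
    then have "p \<subseteq> l'" "q \<subseteq> l'" using contains[OF _ sl] pq by blast+
    then show ?thesis unfolding pq(4) join_def using sl by (intro span_minimal) auto
  qed
  have "inj_on g L0" using g_mono by (intro inj_onI subset_antisym) auto
  moreover have "inj_on f P0" using f(2) by (metis inj_onI)
  moreover have "\<forall>(p, l)\<in>{(p, l). p \<in> P0 \<and> l \<in> L0 \<and> p \<subseteq> l}.
      (f p, g l) \<in> {(p, l). p \<in> f ` P0 \<and> l \<in> g ` L0 \<and> p \<in> l}"
    using inc by auto
  ultimately have "is_subgraph (projective_graph P0 L0) (affine_graph (f ` P0) (g ` L0))"
    unfolding is_subgraph_def incidence_graph_def prod.case
    by (intro exI[of _ f] exI[of _ g] conjI) simp_all
  then show ?thesis using f(1) g_line P0(1) L0(1)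
    by (intro exI[of _ "f ` P0"] exI[of _ "g ` L0"]) auto
qed

lemma line_at_infinity_eq_span:
  fixes s t :: "real^3"
  assumes s: "s $ 3 = 0" and t: "t $ 3 = 0" and ind: "independent {s, t}" "s \<noteq> t"
  shows "span {s, t} = line_at_infinity"
proof (rule subspace_dim_equal)
  have inf: "line_at_infinity = {x. axis 3 1 \<bullet> x = 0}"
    by (auto simp: line_at_infinity_def inner_axis')
  show "subspace line_at_infinity" unfolding inf by (rule subspace_hyperplane)
  then show "span {s, t} \<subseteq> line_at_infinity"
    using s t by (intro span_minimal) (auto simp: line_at_infinity_def)
  have "dim line_at_infinity = 2"
    unfolding inf by (subst dim_hyperplane) (simp_all add: axis_eq_0_iff)
  moreover have "dim (span {s, t}) = 2"
    using ind by (simp add: dim_eq_card_independent)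
  ultimately show "dim line_at_infinity \<le> dim (span {s, t})" by simp
qed simp

text \<open>
Homogeneous coordinates of the vertices, with the first three vertices independent and the others determined
by the closing relation with factor \<open>l\<close>. The last coordinates start with 5, 7, 6 because with this choice those
of all vertices are nonzero and pairwise distinct in the three cases that matter. So neither a vertex nor
the difference of two vertices, a point at infinity of the regular polygon, lies on the line where the last
coordinate vanishes.
\<close>

fun rational_polygon :: "int \<Rightarrow> nat \<Rightarrow> real^3" where
  "rational_polygon l 0 = vector [1, 0, 5]"
| "rational_polygon l (Suc 0) = vector [0, 1, 7]"
| "rational_polygon l (Suc (Suc 0)) = vector [0, 0, 6]"
| "rational_polygon l (Suc (Suc (Suc n))) = rational_polygon l n +
     of_int l *\<^sub>R (rational_polygon l (Suc (Suc n)) - rational_polygon l (Suc n))"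

lemma rational_polygon_Rats: "rational_polygon l n $ i \<in> \<rat>"
proof (induction l n arbitrary: i rule: rational_polygon.induct)
  case (1 l)
  then show ?case using exhaust_3[of i] by auto
next
  case (2 l)
  then show ?case using exhaust_3[of i] by auto
next
  case (3 l)
  then show ?case using exhaust_3[of i] by auto
next
  case (4 l n)
  then show ?case by auto
qed

lemma rational_polygon_last_coordinate:
  assumes "(k, l) \<in> {(3, 0), (4, 1), (6, 2)}"
  shows "inj_on (\<lambda>i. rational_polygon l i $ 3) {..<k}" "i < k \<Longrightarrow> rational_polygon l i $ 3 \<noteq> 0"
  using assms by (auto simp: eval_nat_numeral lessThan_Suc less_Suc_eq)

lemma span_rational_vector:
  fixes C :: "real^3 \<Rightarrow> 'a::real_vector" and X :: "real^3"
  assumes C: "linear C" and X: "\<And>i. X $ i \<in> \<rat>" "X $ 3 \<noteq> 0"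
  shows "\<exists>x\<in>V 1. span {C X} = span {C (homogeneous x)}"
proof
  define x :: "real^2" where "x = vector [X $ 1 / X $ 3, X $ 2 / X $ 3]"
  show "x \<in> V 1"
  proof (rule rational_point_in_V_1)
    show "x $ i \<in> \<rat>" for i using X exhaust_2[of i] by (auto simp: x_def)
  qed
  have "X = (X $ 3) *\<^sub>R homogeneous x"
    using X(2) by (simp add: vec_eq_iff forall_3 x_def)
  then have "C X = (X $ 3) *\<^sub>R C (homogeneous x)" using C by (metis linear_scale)
  then show "span {C X} = span {C (homogeneous x)}" using X(2) span_singleton_scaleR by metis
qed

text \<open>
The map \<open>C\<close> is determined by its values on the first three vertices, and the common closing relation
propagates the correspondence to the other vertices. It is injective since no regular polygon has three
collinear vertices.
\<close>

lemma rational_coordinates_of_extended_polygon: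
  assumes reg: "regular_polygon k v" and k: "k \<in> {3, 4, 6}"
  obtains C :: "real^3 \<Rightarrow> real^3" and l :: int where "linear C" "inj C" "(k, l) \<in> {(3, 0), (4, 1), (6, 2)}"
    "\<And>i. i < k \<Longrightarrow> C (rational_polygon l i) = homogeneous (v i)"
    "independent {homogeneous (v 0) - homogeneous (v 1), homogeneous (v 1) - homogeneous (v 2)}"
    "homogeneous (v 0) - homogeneous (v 1) \<noteq> homogeneous (v 1) - homogeneous (v 2)"
proof -
  obtain l :: int where kl: "(k, l) \<in> {(3, 0), (4, 1), (6, 2)}" using k by blast
  note rec = regular_polygon_closing_relation[OF reg kl]
  obtain \<tau> :: "nat \<Rightarrow> real^3" where chord: "\<And>i j. i < k \<Longrightarrow> j < k \<Longrightarrow> i \<noteq> j \<Longrightarrow>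
      \<exists>c. c \<noteq> 0 \<and> homogeneous (v i) - homogeneous (v j) = c *\<^sub>R \<tau> ((i + j) mod k)"
    and ind: "\<And>a b x y. a < k \<Longrightarrow> b < k \<Longrightarrow> a \<noteq> b \<Longrightarrow> x *\<^sub>R \<tau> a + y *\<^sub>R \<tau> b = 0 \<Longrightarrow> x = 0 \<and> y = 0"
    by (rule regular_polygon_chord_direction[OF reg]) (rule that)
  define e where "e i = homogeneous (v i)" for i
  obtain c where c: "c \<noteq> 0" "e 0 - e 1 = c *\<^sub>R \<tau> 1"
    using chord[of 0 1] k unfolding e_def by auto
  obtain c' where c': "c' \<noteq> 0" "e 1 - e 2 = c' *\<^sub>R \<tau> (3 mod k)"
    using chord[of 1 2] k unfolding e_def by auto
  have indep: "x = 0 \<and> y = 0" if "x *\<^sub>R (e 0 - e 1) + y *\<^sub>R (e 1 - e 2) = 0" for x y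
    using ind[of 1 "3 mod k" "x * c" "y * c'"] that k c c' by auto
  have indep3: "x = 0 \<and> y = 0 \<and> w = 0" if eq: "x *\<^sub>R e 0 + y *\<^sub>R e 1 + w *\<^sub>R e 2 = 0" for x y w
  proof -
    have "x + y + w = (x *\<^sub>R e 0 + y *\<^sub>R e 1 + w *\<^sub>R e 2) $ 3" by (simp add: e_def)
    then have y: "y = - x - w" unfolding eq by simp
    have "x *\<^sub>R (e 0 - e 1) + (- w) *\<^sub>R (e 1 - e 2) = 0"
      using eq unfolding y by (simp add: algebra_simps)
    then show ?thesis using indep y by fastforce
  qed
  \<comment> \<open>The coefficients express \<open>y\<close> in the basis formed by the first three vectors of \<open>rational_polygon\<close>.\<close>
  define C :: "real^3 \<Rightarrow> real^3" where
    "C y = (y $ 1) *\<^sub>R e 0 + (y $ 2) *\<^sub>R e 1 + ((y $ 3 - 5 * y $ 1 - 7 * y $ 2) / 6) *\<^sub>R e 2" for y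
  have lin: "linear C"
    by (rule linearI) (simp_all add: C_def algebra_simps add_divide_distrib diff_divide_distrib)
  have "inj C" unfolding linear_injective_0[OF lin]
  proof (intro allI impI)
    fix y assume "C y = 0"
    then have "y $ 1 = 0 \<and> y $ 2 = 0 \<and> (y $ 3 - 5 * y $ 1 - 7 * y $ 2) / 6 = 0"
      unfolding C_def by (rule indep3)
    then show "y = 0" by (simp add: vec_eq_iff forall_3)
  qed
  have CX: "C (rational_polygon l i) = e i" if "i < k" for i
    using that
  proof (induction i rule: less_induct)
    case (less i)
    consider "i = 0" | "i = 1" | "i = 2" | n where "i = Suc (Suc (Suc n))"
      by (metis One_nat_def Suc_1 not0_implies_Suc)
    then show ?case
    proof cases
      case 4
      have "C (rational_polygon l i) = C (rational_polygon l n) +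
          of_int l *\<^sub>R (C (rational_polygon l (Suc (Suc n))) - C (rational_polygon l (Suc n)))"
        unfolding 4 using lin by (simp add: linear_add linear_scale linear_diff)
      also have "\<dots> = e n + of_int l *\<^sub>R (e (Suc (Suc n)) - e (Suc n))"
        using less 4 by simp
      also have "\<dots> = e i"
        using rec[of n] less.prems unfolding 4 e_def by (simp add: algebra_simps eval_nat_numeral)
      finally show ?thesis .
    qed (simp_all add: C_def numeral_2_eq_2)
  qed
  have ne: "e 0 - e 1 \<noteq> e 1 - e 2" using indep[of 1 "- 1"] by auto
  have "independent {e 0 - e 1, e 1 - e 2}"
  proof -
    have "e 1 - e 2 \<noteq> 0" using indep[of 0 1] by auto
    moreover have "e 0 - e 1 \<notin> span {e 1 - e 2}"
    proof
      assume "e 0 - e 1 \<in> span {e 1 - e 2}"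
      then obtain x where "e 0 - e 1 = x *\<^sub>R (e 1 - e 2)" by (auto simp: span_singleton)
      then show False using indep[of 1 "- x"] by simp
    qed
    ultimately show ?thesis using ne by (simp add: independent_insert)
  qed
  then show thesis using that[OF lin \<open>inj C\<close> kl] CX ne unfolding e_def by blast
qed

lemma finite_secants: "finite (secants k v)"
proof -
  have "secants k v \<subseteq> (\<lambda>(i, j). join (to_projective (v i)) (to_projective (v j))) ` ({..<k} \<times> {..<k})"
    unfolding secants_def by force
  then show ?thesis by (rule finite_subset) simp
qed

text \<open>
In the coordinates given by \<open>rational_polygon\<close>, the vertices and their differences are rational vectors
with nonzero last coordinate, so all points of the extended polygon become rational points of the affine
plane. The line at infinity is spanned by the points at infinity of two consecutive edges.
\<close>

lemma rational_realization:
  assumes img: "image_of_extended_polygon k P0 L0" and k: "k \<in> {3, 4, 6}"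
  shows "\<exists>P L. P \<subseteq> V 1 \<and> finite P \<and> (\<forall>l\<in>L. affine_line l) \<and> finite L \<and>
    is_subgraph (projective_graph P0 L0) (affine_graph P L)"
proof -
  obtain v T where reg: "regular_polygon k v" and T: "projective_transformation T"
    and P0: "P0 = T ` extended_points k v" and L0: "L0 = T ` extended_lines k v"
    using img unfolding image_of_extended_polygon_def by blast
  obtain h where h: "linear h" "bij h" "T = (`) h" using T unfolding projective_transformation_def by blast
  obtain C l where C: "linear C" "inj C" and kl: "(k, l) \<in> {(3, 0), (4, 1), (6, 2)}"
    and CX: "\<And>i. i < k \<Longrightarrow> C (rational_polygon l i) = homogeneous (v i)"
    and ind: "independent {homogeneous (v 0) - homogeneous (v 1), homogeneous (v 1) - homogeneous (v 2)}"
    "homogeneous (v 0) - homogeneous (v 1) \<noteq> homogeneous (v 1) - homogeneous (v 2)"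
    using rational_coordinates_of_extended_polygon[OF reg k] by blast
  let ?e = "\<lambda>i. homogeneous (v i)" and ?p = "\<lambda>i. to_projective (v i)"
  note X3 = rational_polygon_last_coordinate[OF kl]
  have inf: "join (?p i) (?p j) \<inter> line_at_infinity = span {?e i - ?e j}" for i j
    by (rule secant_inter_line_at_infinity[of 1]) simp_all
  have Tspan: "T (span S) = span (h ` S)" for S
    using h by (simp add: linear_span_image)
  have Tjoin: "T (join p q) = join (T p) (T q)" for p q
    unfolding join_def Tspan using h(3) by (simp add: image_Un)
  have Tinj: "T p = T q \<longleftrightarrow> p = q" for p q
    using h by (simp add: inj_image_eq_iff bij_is_inj)
  have points: "\<exists>x\<in>V 1. p = span {C (homogeneous x)}" if p: "p \<in> extended_points k v" for p
    using p unfolding extended_points_def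
  proof
    assume "p \<in> (\<lambda>i. ?p i) ` {..<k}"
    then obtain i where i: "i < k" "p = span {?e i}" by (auto simp: to_projective_eq)
    show ?thesis
      using span_rational_vector[OF C(1) rational_polygon_Rats X3(2)[OF i(1)]] i(2) CX[OF i(1)] by simp
  next
    assume "p \<in> (\<lambda>l. l \<inter> line_at_infinity) ` secants k v"
    then obtain i j where ij: "i < j" "j < k" "p = span {?e i - ?e j}"
      unfolding secants_def using inf by auto
    have "(rational_polygon l i - rational_polygon l j) $ 3 \<noteq> 0"
      using X3(1) ij by (auto dest: inj_onD)
    moreover have "(rational_polygon l i - rational_polygon l j) $ m \<in> \<rat>" for m
      using rational_polygon_Rats by simp
    ultimately have "\<exists>x\<in>V 1. span {C (rational_polygon l i - rational_polygon l j)} = span {C (homogeneous x)}"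
      by (intro span_rational_vector[OF C(1)])
    moreover have "C (rational_polygon l i - rational_polygon l j) = ?e i - ?e j"
      using CX ij C(1) by (simp add: linear_diff)
    ultimately show ?thesis using ij(3) by simp
  qed
  have k3: "2 < k" using k by auto
  have lines: "\<exists>p\<in>extended_points k v. \<exists>q\<in>extended_points k v. p \<noteq> q \<and> l' = join p q"
    if "l' \<in> extended_lines k v" for l'
    using that unfolding extended_lines_def
  proof
    assume l': "l' = line_at_infinity"
    let ?s = "span {?e 0 - ?e 1}" and ?t = "span {?e 1 - ?e 2}"
    have "join (?p 0) (?p 1) \<in> secants k v" "join (?p 1) (?p 2) \<in> secants k v"
      unfolding secants_def using k3 by fastforce+
    then have "?s \<in> extended_points k v" "?t \<in> extended_points k v"
      unfolding extended_points_def inf[symmetric] by blast+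
    moreover have "join ?s ?t = line_at_infinity"
    proof -
      have "join ?s ?t = span {?e 0 - ?e 1, ?e 1 - ?e 2}"
        by (rule join_span_singletons)
      also have "\<dots> = line_at_infinity" using ind by (intro line_at_infinity_eq_span) simp_all
      finally show ?thesis .
    qed
    moreover have "?s \<noteq> ?t"
    proof
      assume "?s = ?t"
      then have "?e 0 - ?e 1 \<in> span {?e 1 - ?e 2}" by (metis singletonI span_base)
      then show False using ind by (simp add: independent_insert)
    qed
    ultimately show ?thesis unfolding l' by blast
  next
    assume "l' \<in> secants k v"
    then obtain i j where ij: "i < j" "j < k" "l' = join (?p i) (?p j)" unfolding secants_def by blast
    have "?p i \<noteq> ?p j"
    proof
      assume "?p i = ?p j"
      then have "?e i \<in> span {?e j}" unfolding to_projective_eq by (metis singletonI span_base)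
      then obtain x where x: "?e i = x *\<^sub>R ?e j" by (auto simp: span_singleton)
      have "x = 1" using arg_cong[OF x, of "\<lambda>p :: real^3. p $ 3"] by simp
      then have "C (rational_polygon l i) = C (rational_polygon l j)" using x CX ij by simp
      then have "rational_polygon l i = rational_polygon l j" using C(2) by (auto dest: injD)
      then show False using inj_onD[OF X3(1), of i j] ij by simp
    qed
    moreover have "?p i \<in> extended_points k v" "?p j \<in> extended_points k v"
      using ij by (simp_all add: extended_points_def)
    ultimately show ?thesis using ij(3) by blast
  qed
  show ?thesis
  proof (rule projective_configuration_in_affine_chart)
    show "linear (h \<circ> C)" using C(1) h(1) by (rule linear_compose)
    show "inj (h \<circ> C)" using C(2) h(2) by (simp add: bij_is_inj inj_compose)
    show "finite P0" unfolding P0 extended_points_def by (simp add: finite_secants)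
    show "finite L0" unfolding L0 extended_lines_def by (simp add: finite_secants)
    show "\<exists>x\<in>V 1. p = span {(h \<circ> C) (homogeneous x)}" if "p \<in> P0" for p
      using that points unfolding P0 by (fastforce simp: Tspan)
    show "\<exists>p\<in>P0. \<exists>q\<in>P0. p \<noteq> q \<and> l' = join p q" if l': "l' \<in> L0" for l'
    proof -
      obtain m where m: "m \<in> extended_lines k v" "l' = T m" using l' unfolding L0 by blast
      obtain p q where pq: "p \<in> extended_points k v" "q \<in> extended_points k v" "p \<noteq> q" "m = join p q"
        using lines[OF m(1)] by blast
      have "T p \<in> P0" "T q \<in> P0" "T p \<noteq> T q" using pq by (simp_all add: P0 Tinj)
      moreover have "l' = join (T p) (T q)" unfolding m(2) pq(4) by (rule Tjoin)
      ultimately show ?thesis by blast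
    qed
  qed
qed

section \<open>Excluded and realizable extended polygons\<close>

theorem theorem2:
  "(\<forall>d::nat. d \<ge> 1 \<longrightarrow>
      (\<exists>k::nat. k \<ge> 3 \<and>
        (\<forall>(m::nat) (n::nat) P0 L0. image_of_extended_polygon k P0 L0 \<longrightarrow>
          (\<forall>P L. P \<subseteq> V d \<and> finite P \<and> card P = m \<and>
                 (\<forall>l\<in>L. affine_line l) \<and> finite L \<and> card L = n \<longrightarrow>
                 \<not> is_subgraph (projective_graph P0 L0) (affine_graph P L)))))
   \<and>
   (\<forall>k::nat. k \<ge> 3 \<longrightarrow>
      (\<forall>P0 L0. image_of_extended_polygon k P0 L0 \<longrightarrow>
        ((\<forall>(m::nat) (n::nat) P L. P \<subseteq> V 1 \<and> finite P \<and> card P = m \<and>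
                 (\<forall>l\<in>L. affine_line l) \<and> finite L \<and> card L = n \<longrightarrow>
                 \<not> is_subgraph (projective_graph P0 L0) (affine_graph P L))
         \<longleftrightarrow> k \<notin> {3, 4, 6})))"
proof (intro conjI allI impI)
  fix d :: nat assume d: "d \<ge> 1"
  \<comment> \<open>With \<open>k = 2\<^sup>n\<^sup>+\<^sup>1\<close> the trace has degree at least \<open>2\<^sup>n\<^sup>-\<^sup>1\<close>, which exceeds \<open>d\<^sup>1\<^sup>2 = n - 1\<close>.\<close>
  define n where "n = Suc (d ^ 12)"
  have "d ^ 12 \<ge> 1" using d by simp
  then have k: "2 ^ Suc n \<ge> (5::nat)"
    using power_increasing[of 3 "Suc n" "2::nat"] by (simp add: n_def)
  have "\<not> is_subgraph (projective_graph P0 L0) (affine_graph P L)"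
    if img: "image_of_extended_polygon (2 ^ Suc n) P0 L0" and P: "P \<subseteq> V d" and L: "\<forall>l\<in>L. affine_line l"
    for P0 L0 P L
  proof
    assume "is_subgraph (projective_graph P0 L0) (affine_graph P L)"
    from embedding_imp_realization[OF img k this P L d] obtain \<mu> z and p :: "rat poly"
      where z: "primitive_root_of_unity (2 ^ Suc n) z" "of_real \<mu> = z + 1 / z"
        and p: "p \<noteq> 0" "degree p \<le> d ^ 12" "poly (map_poly of_rat p) \<mu> = 0" by blast
    have "2 ^ n \<le> 2 * degree p" by (rule degree_bound_trace_2_power[OF z p(1,3)])
    then have "2 ^ (d ^ 12) \<le> d ^ 12" using p(2) by (simp add: n_def)
    then show False using less_exp[of "d ^ 12"] by simp
  qed
  then show "\<exists>k\<ge>3. \<forall>(m::nat) (n::nat) P0 L0. image_of_extended_polygon k P0 L0 \<longrightarrow>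
          (\<forall>P L. P \<subseteq> V d \<and> finite P \<and> card P = m \<and>
                 (\<forall>l\<in>L. affine_line l) \<and> finite L \<and> card L = n \<longrightarrow>
                 \<not> is_subgraph (projective_graph P0 L0) (affine_graph P L))"
    using k by (intro exI[of _ "2 ^ Suc n"]) auto
next
  fix k :: nat and P0 L0
  assume k: "k \<ge> 3" and img: "image_of_extended_polygon k P0 L0"
  show "(\<forall>(m::nat) (n::nat) P L. P \<subseteq> V 1 \<and> finite P \<and> card P = m \<and>
                 (\<forall>l\<in>L. affine_line l) \<and> finite L \<and> card L = n \<longrightarrow>
                 \<not> is_subgraph (projective_graph P0 L0) (affine_graph P L))
         \<longleftrightarrow> k \<notin> {3, 4, 6}" (is "?no_embedding \<longleftrightarrow> _")
  proof
    assume ?no_embedding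
    then show "k \<notin> {3, 4, 6}" using rational_realization[OF img] by blast
  next
    assume k346: "k \<notin> {3, 4, 6}"
    then have k5: "k \<ge> 5" using k by auto
    have "\<not> is_subgraph (projective_graph P0 L0) (affine_graph P L)"
      if P: "P \<subseteq> V 1" and L: "\<forall>l\<in>L. affine_line l" for P L
    proof
      assume "is_subgraph (projective_graph P0 L0) (affine_graph P L)"
      from embedding_imp_realization[OF img k5 this P L] obtain \<mu> z and p :: "rat poly"
        where z: "primitive_root_of_unity k z" "of_real \<mu> = z + 1 / z"
          and p: "p \<noteq> 0" "degree p \<le> 1" "poly (map_poly of_rat p) \<mu> = 0" by auto
      obtain a p' where p': "p = pCons a p'" by (rule pCons_cases)
      have "degree p' = 0" using p(2) by (cases "p' = 0") (auto simp: p')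
      then obtain b where "p' = [:b:]" by (rule degree_eq_zeroE)
      then have ab: "p = [:a, b:]" by (simp add: p')
      have root: "of_rat a + \<mu> * of_rat b = 0" using p(3) by (simp add: ab map_poly_pCons)
      then have "b \<noteq> 0" using p(1) by (auto simp: ab)
      then have "\<mu> = of_rat (- a / b)" using root
        by (simp add: of_rat_divide of_rat_minus field_simps add_eq_0_iff)
      then have "\<mu> \<in> \<rat>" by simp
      then show False using rational_trace_of_root_of_unity[OF z _ k5] k346 by simp
    qed
    then show ?no_embedding by blast
  qed
qed

end
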